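(* Let $\mathcal{M}''_m$ be a meridian surface of hyperbolic type in the Minkowski space $\mathbb{R}^4_1$, parameterized by $z(u,v)=f(u)\,l(v)+g(u)\,e_1$, $u\in I$, $v\in J$, constructed from the meridian curve $m:u\mapsto(f(u),g(u))$ and the curve $c:l=l(v)$ with spherical curvature $\kappa$. Then $\mathcal{M}''_m$ has pointwise 1-type Gauss map of first kind if and only if one of the following cases holds: (i) the curve $c$ has zero spherical curvature and the meridian curve $m$ is determined by a solution $f(u)$ of the differential equation $$f\left(\frac{f f''}{\sqrt{1-f'^2}}\right)'+f'\sqrt{1-f'^2}=0,$$ with $g(u)$ defined by $g'(u)=\sqrt{1-f'^2(u)}$; (ii) the curve $c$ has non-zero constant spherical curvature $\kappa$ ($\kappa\neq\pm1$) and the meridian curve $m$ is determined by $f(u)=a$, $g(u)=\pm u+b$, where $a=\mathrm{const}$, $b=\mathrm{const}$. Moreover, $\mathcal{M}''_m$ is (in this case) a developable ruled surface lying in a constant hyperplane $\mathbb{E}^3_1$ (if $\kappa^2-1>0$) or $\mathbb{E}^3$ (if $\kappa^2-1<0$) of $\mathbb{R}^4_1$.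
   Context: $\mathbb{R}^4_1$ (also written $\mathbb{E}^4_1$) is the four-dimensional Minkowski space with flat metric $\langle\cdot,\cdot\rangle$ of signature $(3,1)$ and fixed orthonormal frame $e_1,e_2,e_3,e_4$, $\langle e_i,e_i\rangle=1$ for $i=1,2,3$, $\langle e_4,e_4\rangle=-1$. Meridian surface of hyperbolic type: let $f,g:I\to\mathbb{R}$ be smooth functions on an interval $I\subset\mathbb{R}$ with $f(u)>0$ and $(f'(u))^2+(g'(u))^2=1$ for all $u\in I$ (the plane curve $m:u\mapsto(f(u),g(u))$ is called the meridian curve). Let $c:l=l(v)$, $v\in J$ ($J\subset\mathbb{R}$ an interval), be a smooth curve with $\langle l',l'\rangle=1$ on the de Sitter space $S^2_1(1)=\{V\in\mathbb{R}^3_1:\langle V,V\rangle=1\}$, where $\mathbb{R}^3_1=\operatorname{span}\{e_2,e_3,e_4\}$. The surface $\mathcal{M}''_m:z(u,v)=f(u)\,l(v)+g(u)\,e_1$, $u\in I,\ v\in J$, is called a meridian surface of hyperbolic type; it is spacelike with first fundamental form $du^2+f^2(u)\,dv^2$. Spherical curvature of $c$: put $t=l'$ and let $n(v)$ be the (unique up to sign) vector field such that $\{l,t,n\}$ is an orthonormal frame field of $\mathbb{R}^3_1$, with $\langle n,n\rangle=-1$; then $\kappa(v)=\langle t'(v),n(v)\rangle$, and $l'=t$, $t'=-\kappa n-l$, $n'=-\kappa t$. Gauss map: with $x=z_u$ and $y=z_v/f$ (an orthonormal tangent frame), the Gauss map is $G=x\wedge y$, regarded as a map from the surface into the vector space $\wedge^2\mathbb{R}^4_1$,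 equipped with the indefinite inner product $\langle a_1\wedge a_2,b_1\wedge b_2\rangle=\det(\langle a_k,b_l\rangle)$. Laplacian: $\Delta G=-\nabla'_x\nabla'_xG+\nabla'_{\nabla_xx}G-\nabla'_y\nabla'_yG+\nabla'_{\nabla_yy}G$, where $\nabla'$ is the flat connection of the ambient space (componentwise differentiation) and $\nabla$ is the Levi-Civita connection of the surface. The surface has pointwise 1-type Gauss map of first kind if $\Delta G=\lambda G$ for some non-zero smooth function $\lambda$ on the surface. A ruled surface is developable if its tangent plane (equivalently its normal space) is constant along each generator. A hyperplane $\mathbb{E}^3$ (resp. $\mathbb{E}^3_1$) of $\mathbb{R}^4_1$ is an affine hyperplane on which the induced metric is positive definite (resp. Lorentzian, of signature $(2,1)$).
   Formalization: In case (i), g' = √(1−f'²) is corrected to g' = ±√(1−f'²), sign may vary with u, and the differential equation is required only where f'² < 1, a set that must be non-empty; as stated "only if" fails, e.g. for κ = 0, f = a, g = −u. *)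

theory Defs
  imports "HOL-Analysis.Analysis"
begin

section \<open>Smooth maps and derivatives on intervals\<close>

text \<open>All derivatives are taken within the domain, so that intervals may contain their end points.\<close>

primrec C_diff_on ::
  "nat \<Rightarrow> 'a::real_normed_vector set \<Rightarrow> ('a \<Rightarrow> 'b::real_normed_vector) \<Rightarrow> bool" where
  "C_diff_on 0 S F \<longleftrightarrow> continuous_on S F"
| "C_diff_on (Suc k) S F \<longleftrightarrow>
     (\<exists>F'. (\<forall>p\<in>S. (F has_derivative F' p) (at p within S)) \<and>
           (\<forall>h. C_diff_on k S (\<lambda>p. F' p h)))"

definition smooth_on ::
  "'a::real_normed_vector set \<Rightarrow> ('a \<Rightarrow> 'b::real_normed_vector) \<Rightarrow> bool" where
  "smooth_on S F \<longleftrightarrow> (\<forall>k. C_diff_on k S F)"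

definition nondeg_interval :: "real set \<Rightarrow> bool" where
  "nondeg_interval I \<longleftrightarrow> is_interval I \<and> interior I \<noteq> {}"

definition deriv_on :: "real set \<Rightarrow> (real \<Rightarrow> 'b::real_normed_vector) \<Rightarrow> real \<Rightarrow> 'b" where
  "deriv_on I F u = vector_derivative F (at u within I)"


section \<open>Minkowski space and bivectors\<close>

definition mink :: "real^4 \<Rightarrow> real^4 \<Rightarrow> real" where
  "mink a b = a$1 * b$1 + a$2 * b$2 + a$3 * b$3 - a$4 * b$4"

abbreviation e1 :: "real^4" where "e1 \<equiv> axis 1 1"
abbreviation e2 :: "real^4" where "e2 \<equiv> axis 2 1"
abbreviation e3 :: "real^4" where "e3 \<equiv> axis 3 1"
abbreviation e4 :: "real^4" where "e4 \<equiv> axis 4 1"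

definition mink3 :: "(real^4) set" where
  "mink3 = span {e2, e3, e4}"

definition de_sitter :: "(real^4) set" where
  "de_sitter = {V \<in> mink3. mink V V = 1}"

text \<open>The second exterior power is realised as the space of skew-symmetric \<open>4 \<times> 4\<close> matrices.\<close>

definition wedge :: "real^4 \<Rightarrow> real^4 \<Rightarrow> real^4^4"  (infixl "\<and>\<^sub>w" 70) where
  "a \<and>\<^sub>w b = (\<chi> i j. a$i * b$j - a$j * b$i)"

definition bivector_inner :: "real^4^4 \<Rightarrow> real^4^4 \<Rightarrow> real" where
  "bivector_inner A B =
     (\<Sum>i\<in>UNIV. \<Sum>j\<in>UNIV. mink (axis i 1) (axis i 1) * mink (axis j 1) (axis j 1) * A$i$j * B$i$j) / 2"

text \<open>The Gauss map equation only uses the linear structure of the bivectors; the following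
  confirms that the matrix model carries the intended indefinite inner product.\<close>

lemma bivector_inner_wedge:
  "bivector_inner (a1 \<and>\<^sub>w a2) (b1 \<and>\<^sub>w b2) =
     mink a1 b1 * mink a2 b2 - mink a1 b2 * mink a2 b1"
  unfolding bivector_inner_def wedge_def mink_def
  by (simp add: sum_4 axis_def field_simps)


section \<open>The meridian surface\<close>

definition meridian_surface ::
  "(real \<Rightarrow> real) \<Rightarrow> (real \<Rightarrow> real) \<Rightarrow> (real \<Rightarrow> real^4) \<Rightarrow> real \<Rightarrow> real \<Rightarrow> real^4" where
  "meridian_surface f g l u v = f u *\<^sub>R l v + g u *\<^sub>R e1"

definition spherical_curvature ::
  "real set \<Rightarrow> (real \<Rightarrow> real^4) \<Rightarrow> (real \<Rightarrow> real^4) \<Rightarrow> real \<Rightarrow> real" where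
  "spherical_curvature J l n v = mink (deriv_on J (deriv_on J l) v) (n v)"

definition partial_u ::
  "real set \<Rightarrow> (real \<Rightarrow> real \<Rightarrow> 'b::real_normed_vector) \<Rightarrow> real \<Rightarrow> real \<Rightarrow> 'b" where
  "partial_u I F u v = deriv_on I (\<lambda>s. F s v) u"

definition partial_v ::
  "real set \<Rightarrow> (real \<Rightarrow> real \<Rightarrow> 'b::real_normed_vector) \<Rightarrow> real \<Rightarrow> real \<Rightarrow> 'b" where
  "partial_v J F u v = deriv_on J (\<lambda>s. F u s) v"

text \<open>Maps on the surface are written in the parameters \<open>(u, v)\<close>. The flat derivatives along
  \<open>x = z\<^sub>u\<close> and \<open>y = z\<^sub>v / f\<close> are therefore \<open>\<partial>\<^sub>u\<close> and \<open>\<partial>\<^sub>v / f\<close>.\<close>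

definition flat_x ::
  "real set \<Rightarrow> (real \<Rightarrow> real \<Rightarrow> 'b::real_normed_vector) \<Rightarrow> real \<Rightarrow> real \<Rightarrow> 'b" where
  "flat_x I F u v = partial_u I F u v"

definition flat_y ::
  "real set \<Rightarrow> (real \<Rightarrow> real) \<Rightarrow> (real \<Rightarrow> real \<Rightarrow> 'b::real_normed_vector) \<Rightarrow> real \<Rightarrow> real \<Rightarrow> 'b" where
  "flat_y J f F u v = (1 / f u) *\<^sub>R partial_v J F u v"

definition frame_x ::
  "real set \<Rightarrow> (real \<Rightarrow> real) \<Rightarrow> (real \<Rightarrow> real) \<Rightarrow> (real \<Rightarrow> real^4) \<Rightarrow> real \<Rightarrow> real \<Rightarrow> real^4" where
  "frame_x I f g l = partial_u I (meridian_surface f g l)"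

definition frame_y ::
  "real set \<Rightarrow> (real \<Rightarrow> real) \<Rightarrow> (real \<Rightarrow> real) \<Rightarrow> (real \<Rightarrow> real^4) \<Rightarrow> real \<Rightarrow> real \<Rightarrow> real^4" where
  "frame_y J f g l u v = (1 / f u) *\<^sub>R partial_v J (meridian_surface f g l) u v"

definition gauss_map ::
  "real set \<Rightarrow> real set \<Rightarrow> (real \<Rightarrow> real) \<Rightarrow> (real \<Rightarrow> real) \<Rightarrow> (real \<Rightarrow> real^4) \<Rightarrow>
   real \<Rightarrow> real \<Rightarrow> real^4^4" where
  "gauss_map I J f g l u v = frame_x I f g l u v \<and>\<^sub>w frame_y J f g l u v"

text \<open>The frame \<open>x, y\<close> is orthonormal, so \<open>\<langle>w, x\<rangle> x + \<langle>w, y\<rangle> y\<close> is the tangential part of \<open>w\<close>.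
  The Levi-Civita connection is the tangential part of the flat one (Gauss formula).\<close>

definition tangent_part ::
  "real set \<Rightarrow> real set \<Rightarrow> (real \<Rightarrow> real) \<Rightarrow> (real \<Rightarrow> real) \<Rightarrow> (real \<Rightarrow> real^4) \<Rightarrow>
   (real \<Rightarrow> real \<Rightarrow> real^4) \<Rightarrow> real \<Rightarrow> real \<Rightarrow> real^4" where
  "tangent_part I J f g l W u v =
     mink (W u v) (frame_x I f g l u v) *\<^sub>R frame_x I f g l u v +
     mink (W u v) (frame_y J f g l u v) *\<^sub>R frame_y J f g l u v"

definition levi_civita_x ::
  "real set \<Rightarrow> real set \<Rightarrow> (real \<Rightarrow> real) \<Rightarrow> (real \<Rightarrow> real) \<Rightarrow> (real \<Rightarrow> real^4) \<Rightarrow>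
   (real \<Rightarrow> real \<Rightarrow> real^4) \<Rightarrow> real \<Rightarrow> real \<Rightarrow> real^4" where
  "levi_civita_x I J f g l W = tangent_part I J f g l (flat_x I W)"

definition levi_civita_y ::
  "real set \<Rightarrow> real set \<Rightarrow> (real \<Rightarrow> real) \<Rightarrow> (real \<Rightarrow> real) \<Rightarrow> (real \<Rightarrow> real^4) \<Rightarrow>
   (real \<Rightarrow> real \<Rightarrow> real^4) \<Rightarrow> real \<Rightarrow> real \<Rightarrow> real^4" where
  "levi_civita_y I J f g l W = tangent_part I J f g l (flat_y J f W)"

text \<open>\<open>\<nabla>'\<^sub>W F\<close> for a tangent vector field \<open>W = \<langle>W, x\<rangle> x + \<langle>W, y\<rangle> y\<close>.\<close>

definition flat_along ::
  "real set \<Rightarrow> real set \<Rightarrow> (real \<Rightarrow> real) \<Rightarrow> (real \<Rightarrow> real) \<Rightarrow> (real \<Rightarrow> real^4) \<Rightarrow>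
   (real \<Rightarrow> real \<Rightarrow> real^4) \<Rightarrow> (real \<Rightarrow> real \<Rightarrow> 'b::real_normed_vector) \<Rightarrow> real \<Rightarrow> real \<Rightarrow> 'b" where
  "flat_along I J f g l W F u v =
     mink (W u v) (frame_x I f g l u v) *\<^sub>R flat_x I F u v +
     mink (W u v) (frame_y J f g l u v) *\<^sub>R flat_y J f F u v"

definition surface_laplacian ::
  "real set \<Rightarrow> real set \<Rightarrow> (real \<Rightarrow> real) \<Rightarrow> (real \<Rightarrow> real) \<Rightarrow> (real \<Rightarrow> real^4) \<Rightarrow>
   (real \<Rightarrow> real \<Rightarrow> 'b::real_normed_vector) \<Rightarrow> real \<Rightarrow> real \<Rightarrow> 'b" where
  "surface_laplacian I J f g l F u v =
     - flat_x I (flat_x I F) u v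
     + flat_along I J f g l (levi_civita_x I J f g l (frame_x I f g l)) F u v
     - flat_y J f (flat_y J f F) u v
     + flat_along I J f g l (levi_civita_y I J f g l (frame_y J f g l)) F u v"

text \<open>\<open>\<phi>\<close> is non-zero as a function, i.e. not identically zero. For these surfaces it then has no
  zeros at all.\<close>

definition pointwise_1_type_first_kind ::
  "real set \<Rightarrow> real set \<Rightarrow> (real \<Rightarrow> real) \<Rightarrow> (real \<Rightarrow> real) \<Rightarrow> (real \<Rightarrow> real^4) \<Rightarrow> bool" where
  "pointwise_1_type_first_kind I J f g l \<longleftrightarrow>
     (\<exists>\<phi>. smooth_on (I \<times> J) (\<lambda>(u, v). \<phi> u v) \<and>
          (\<exists>u\<in>I. \<exists>v\<in>J. \<phi> u v \<noteq> (0::real)) \<and>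
          (\<forall>u\<in>I. \<forall>v\<in>J. surface_laplacian I J f g l (gauss_map I J f g l) u v =
                          \<phi> u v *\<^sub>R gauss_map I J f g l u v))"


section \<open>The two cases\<close>

text \<open>The differential equation divides by \<open>\<surd>(1 - f'\<^sup>2)\<close>, so it is required where \<open>f'\<^sup>2 < 1\<close>, and
  that set must not be empty (otherwise the Gauss map is harmonic when \<open>\<kappa> = 0\<close>). A unit speed meridian curve of a surface with pointwise 1-type
  Gauss map of first kind may have isolated points with \<open>f'\<^sup>2 = 1\<close>, at which \<open>g'\<close> changes sign;
  hence \<open>g'\<close> is \<open>\<surd>(1 - f'\<^sup>2)\<close> up to sign.\<close>

definition meridian_ode_case :: "real set \<Rightarrow> (real \<Rightarrow> real) \<Rightarrow> (real \<Rightarrow> real) \<Rightarrow> bool" where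
  "meridian_ode_case I f g \<longleftrightarrow>
     (\<exists>u\<in>I. (deriv_on I f u)\<^sup>2 < 1) \<and>
     (\<forall>u\<in>I. (deriv_on I f u)\<^sup>2 < 1 \<longrightarrow>
        f u * deriv_on I (\<lambda>s. f s * deriv_on I (deriv_on I f) s / sqrt (1 - (deriv_on I f s)\<^sup>2)) u
        + deriv_on I f u * sqrt (1 - (deriv_on I f u)\<^sup>2) = 0) \<and>
     (\<forall>u\<in>I. \<bar>deriv_on I g u\<bar> = sqrt (1 - (deriv_on I f u)\<^sup>2))"

definition meridian_line_case :: "real set \<Rightarrow> (real \<Rightarrow> real) \<Rightarrow> (real \<Rightarrow> real) \<Rightarrow> bool" where
  "meridian_line_case I f g \<longleftrightarrow>
     (\<exists>a b. (\<forall>u\<in>I. f u = a) \<and> ((\<forall>u\<in>I. g u = u + b) \<or> (\<forall>u\<in>I. g u = - u + b)))"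


section \<open>Developable ruled surfaces and hyperplanes\<close>

text \<open>The generators are the parameter lines \<open>v = const\<close>.\<close>

definition ruled_surface ::
  "real set \<Rightarrow> real set \<Rightarrow> (real \<Rightarrow> real \<Rightarrow> real^4) \<Rightarrow> bool" where
  "ruled_surface I J z \<longleftrightarrow>
     (\<exists>\<alpha> \<beta>. smooth_on J \<alpha> \<and> smooth_on J \<beta> \<and> (\<forall>v\<in>J. \<beta> v \<noteq> 0) \<and>
            (\<forall>u\<in>I. \<forall>v\<in>J. z u v = \<alpha> v + u *\<^sub>R \<beta> v))"

definition tangent_plane ::
  "real set \<Rightarrow> real set \<Rightarrow> (real \<Rightarrow> real \<Rightarrow> real^4) \<Rightarrow> real \<Rightarrow> real \<Rightarrow> (real^4) set" where
  "tangent_plane I J z u v = span {partial_u I z u v, partial_v J z u v}"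

definition developable_ruled_surface ::
  "real set \<Rightarrow> real set \<Rightarrow> (real \<Rightarrow> real \<Rightarrow> real^4) \<Rightarrow> bool" where
  "developable_ruled_surface I J z \<longleftrightarrow>
     ruled_surface I J z \<and>
     (\<forall>v\<in>J. \<forall>u\<in>I. \<forall>u'\<in>I. tangent_plane I J z u v = tangent_plane I J z u' v)"

definition euclidean_hyperplane :: "(real^4) set \<Rightarrow> bool" where
  "euclidean_hyperplane H \<longleftrightarrow>
     (\<exists>p V. subspace V \<and> dim V = 3 \<and> H = (+) p ` V \<and> (\<forall>w\<in>V. w \<noteq> 0 \<longrightarrow> mink w w > 0))"

definition lorentzian_hyperplane :: "(real^4) set \<Rightarrow> bool" where
  "lorentzian_hyperplane H \<longleftrightarrow>
     (\<exists>p V b1 b2 b3. subspace V \<and> dim V = 3 \<and> H = (+) p ` V \<and> V = span {b1, b2, b3} \<and>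
        mink b1 b1 = 1 \<and> mink b2 b2 = 1 \<and> mink b3 b3 = -1 \<and>
        mink b1 b2 = 0 \<and> mink b1 b3 = 0 \<and> mink b2 b3 = 0)"

definition lies_in :: "real set \<Rightarrow> real set \<Rightarrow> (real \<Rightarrow> real \<Rightarrow> real^4) \<Rightarrow> (real^4) set \<Rightarrow> bool" where
  "lies_in I J z H \<longleftrightarrow> (\<forall>u\<in>I. \<forall>v\<in>J. z u v \<in> H)"

end

theory Submission
  imports Defs
begin

text \<open>In the basis of bivectors formed from \<open>e1, l, t, n\<close>, the equation \<open>\<Delta>G = \<phi> G\<close> says
  \<open>f' \<kappa>' = f' \<kappa> = g' \<kappa>' = 0\<close> together with two equations along \<open>l \<and> t\<close> and \<open>e1 \<and> t\<close>.
  As \<open>f'\<close> and \<open>g'\<close> do not vanish together, \<open>\<kappa>\<close> is constant. If \<open>\<kappa> \<noteq> 0\<close> then \<open>f' = 0\<close> and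
  \<open>\<phi> = (1 - \<kappa>\<^sup>2) / f\<^sup>2\<close>. If \<open>\<kappa> = 0\<close>, let \<open>k = f'' g' - f' g''\<close> be the curvature of the meridian: the
  component of the two equations along the velocity \<open>(f', g')\<close> is \<open>\<phi> = k\<^sup>2 + g'\<^sup>2 / f\<^sup>2\<close>, and the
  orthogonal one is \<open>f (f k)' + f' g' = 0\<close>, which is the differential equation because
  \<open>f'' = k g'\<close>.\<close>

section \<open>Calculus within intervals\<close>

lemma C_diff_on_cong:
  assumes "C_diff_on k S F" and "\<And>p. p \<in> S \<Longrightarrow> F p = G p"
  shows "C_diff_on k S G"
proof (cases k)
  case 0
  then show ?thesis using assms by (simp cong: continuous_on_cong)
next
  case (Suc m)
  with assms obtain F' where F': "\<And>p. p \<in> S \<Longrightarrow> (F has_derivative F' p) (at p within S)"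
    and "\<And>h. C_diff_on m S (\<lambda>p. F' p h)"
    by auto
  moreover have "(G has_derivative F' p) (at p within S)" if "p \<in> S" for p
    by (rule has_derivative_transform[OF that _ F'[OF that]]) (simp add: assms(2))
  ultimately show ?thesis using Suc by auto
qed

text \<open>At the bottom this is continuity of differentiable maps; above it the same derivative
  serves as witness. The product rule needs it, as it multiplies a function by derivatives of one
  order less.\<close>

lemma C_diff_on_SucD: "C_diff_on (Suc k) S F \<Longrightarrow> C_diff_on k S F"
proof (induction k arbitrary: F)
  case 0
  then show ?case
    by (simp only: C_diff_on.simps) (metis has_derivative_continuous_on)
next
  case (Suc k)
  from Suc.prems obtain F' where "\<forall>p\<in>S. (F has_derivative F' p) (at p within S)"
    and "\<And>h. C_diff_on (Suc k) S (\<lambda>p. F' p h)"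
    by (auto simp del: C_diff_on.simps simp: C_diff_on.simps(2)[of "Suc k"])
  with Suc.IH show ?case by auto
qed

lemma C_diff_on_const: "C_diff_on k S (\<lambda>p. c)"
proof (induction k arbitrary: c)
  case (Suc k)
  then show ?case by (auto intro!: exI[of _ "\<lambda>p h. 0"])
qed simp

lemma C_diff_on_add:
  "C_diff_on k S F \<Longrightarrow> C_diff_on k S G \<Longrightarrow> C_diff_on k S (\<lambda>p. F p + G p)"
proof (induction k arbitrary: F G)
  case 0
  then show ?case by (simp add: continuous_on_add)
next
  case (Suc k)
  from Suc.prems(1) obtain F' where "\<And>p. p \<in> S \<Longrightarrow> (F has_derivative F' p) (at p within S)"
    and "\<And>h. C_diff_on k S (\<lambda>p. F' p h)"
    by auto
  moreover from Suc.prems(2) obtain G' where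
      "\<And>p. p \<in> S \<Longrightarrow> (G has_derivative G' p) (at p within S)"
    and "\<And>h. C_diff_on k S (\<lambda>p. G' p h)"
    by auto
  ultimately show ?case
    using Suc.IH by (auto intro!: exI[of _ "\<lambda>p h. F' p h + G' p h"] has_derivative_add)
qed

text \<open>The Leibniz derivative pairs each factor with the derivative of the other; lowering the
  order of the undifferentiated factor brings both products under the induction hypothesis.\<close>

lemma (in bounded_bilinear) C_diff_on_prod:
  "C_diff_on k S F \<Longrightarrow> C_diff_on k S G \<Longrightarrow> C_diff_on k S (\<lambda>p. prod (F p) (G p))"
proof (induction k arbitrary: F G)
  case 0
  then show ?case by (simp add: continuous_on)
next
  case (Suc k)
  from Suc.prems(1) obtain F' where F': "\<And>p. p \<in> S \<Longrightarrow> (F has_derivative F' p) (at p within S)"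
    and hF: "\<And>h. C_diff_on k S (\<lambda>p. F' p h)"
    by auto
  from Suc.prems(2) obtain G' where G': "\<And>p. p \<in> S \<Longrightarrow> (G has_derivative G' p) (at p within S)"
    and hG: "\<And>h. C_diff_on k S (\<lambda>p. G' p h)"
    by auto
  have "C_diff_on k S (\<lambda>p. prod (F p) (G' p h) + prod (F' p h) (G p))" for h
    by (rule C_diff_on_add[OF Suc.IH[OF C_diff_on_SucD[OF Suc.prems(1)] hG]
          Suc.IH[OF hF C_diff_on_SucD[OF Suc.prems(2)]]])
  with F' G' show ?case
    by (auto intro!: exI[of _ "\<lambda>p h. prod (F p) (G' p h) + prod (F' p h) (G p)"] FDERIV)
qed

text \<open>The derivative of the reciprocal contains the reciprocal itself, but only to one order
  less, which the induction hypothesis supplies.\<close>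

lemma C_diff_on_inverse:
  fixes F :: "'a::real_normed_vector \<Rightarrow> real"
  assumes "\<And>p. p \<in> S \<Longrightarrow> F p \<noteq> 0"
  shows "C_diff_on k S F \<Longrightarrow> C_diff_on k S (\<lambda>p. inverse (F p))"
proof (induction k)
  case 0
  then show ?case using assms by (auto intro: continuous_on_inverse)
next
  case (Suc k)
  then obtain F' where F': "\<And>p. p \<in> S \<Longrightarrow> (F has_derivative F' p) (at p within S)"
    and h: "\<And>h. C_diff_on k S (\<lambda>p. F' p h)"
    by auto
  have inv: "C_diff_on k S (\<lambda>p. inverse (F p))"
    using Suc C_diff_on_SucD by blast
  \<comment> \<open>The sign is written as a constant factor, so that the product rule alone covers
    the expression.\<close>
  have "C_diff_on k S (\<lambda>p. - 1 * (inverse (F p) * F' p h * inverse (F p)))" for h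
    by (intro bounded_bilinear.C_diff_on_prod[OF bounded_bilinear_mult] inv h C_diff_on_const)
  moreover have "((\<lambda>p. inverse (F p)) has_derivative
      (\<lambda>h. - 1 * (inverse (F p) * F' p h * inverse (F p)))) (at p within S)" if "p \<in> S" for p
    using Deriv.has_derivative_inverse[OF assms F'] that by simp
  ultimately show ?case
    unfolding C_diff_on.simps
    by (intro exI[of _ "\<lambda>p h. - 1 * (inverse (F p) * F' p h * inverse (F p))"]) blast
qed

text \<open>Lifts smoothness in \<open>u\<close> to the rectangle on which \<open>\<phi>\<close> has
  to be smooth.\<close>

lemma C_diff_on_fst:
  "C_diff_on k I F \<Longrightarrow> C_diff_on k (I \<times> J) (\<lambda>p. F (fst p))"
proof (induction k arbitrary: F)
  case 0
  then show ?case
    by (auto intro!: continuous_on_compose2[of I F] continuous_intros)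
next
  case (Suc k)
  then obtain F' where F': "\<And>p. p \<in> I \<Longrightarrow> (F has_derivative F' p) (at p within I)"
    and h: "\<And>h. C_diff_on k I (\<lambda>p. F' p h)"
    by auto
  have "((\<lambda>p. F (fst p)) has_derivative (\<lambda>h. F' (fst p) (fst h))) (at p within I \<times> J)"
    if "p \<in> I \<times> J" for p
    using that by (intro has_derivative_in_compose2[of I F F' fst] F')
      (auto intro!: derivative_eq_intros)
  with Suc.IH[OF h] show ?case
    by (auto intro!: exI[of _ "\<lambda>p h. F' (fst p) (fst h)"])
qed

section \<open>Derivatives within a nondegenerate interval\<close>

lemma nondeg_interval_nonempty:
  assumes "nondeg_interval I"
  obtains u where "u \<in> I"
  using assms interior_subset unfolding nondeg_interval_def by blast

text \<open>A connected set other than a singleton has no isolated points, and a singleton has empty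
  interior. This makes derivatives within \<open>I\<close> unique, end points included.\<close>

lemma nondeg_interval_nontrivial:
  assumes "nondeg_interval I" "u \<in> I"
  shows "at u within I \<noteq> bot"
proof -
  have "I \<noteq> {x}" for x
    using assms by (auto simp: nondeg_interval_def)
  moreover have "connected I"
    using assms by (simp add: nondeg_interval_def is_interval_connected)
  ultimately have "u islimpt I"
    using connected_imp_perfect[of I u] assms(2) by simp
  then show ?thesis
    by (simp add: trivial_limit_within)
qed

lemma deriv_on_eqI:
  assumes "nondeg_interval I" "u \<in> I" "(F has_vector_derivative D) (at u within I)"
  shows "deriv_on I F u = D"
  unfolding deriv_on_def
  using assms nondeg_interval_nontrivial vector_derivative_within by blast

lemma smooth_on_has_deriv_on:
  assumes "nondeg_interval I" "u \<in> I" "smooth_on I F"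
  shows "(F has_vector_derivative deriv_on I F u) (at u within I)"
proof -
  have "C_diff_on (Suc 0) I F" using assms(3) smooth_on_def by blast
  then obtain D where "(F has_derivative D) (at u within I)"
    using assms(2) by auto
  then have "F differentiable at u within I"
    by (rule differentiableI)
  then show ?thesis
    unfolding deriv_on_def using vector_derivative_works by blast
qed

text \<open>A derivative on the line is linear in a real increment, hence determined by its value at
  1; by uniqueness this value is \<open>deriv_on\<close>.\<close>

lemma smooth_on_deriv_on:
  assumes "nondeg_interval I" "smooth_on I F"
  shows "smooth_on I (deriv_on I F)"
  unfolding smooth_on_def
proof
  fix k
  have "C_diff_on (Suc k) I F" using assms(2) smooth_on_def by blast
  then obtain F' where F': "\<And>p. p \<in> I \<Longrightarrow> (F has_derivative F' p) (at p within I)"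
    and h: "C_diff_on k I (\<lambda>p. F' p 1)"
    by auto
  show "C_diff_on k I (deriv_on I F)"
  proof (rule C_diff_on_cong[OF h])
    fix p assume p: "p \<in> I"
    have "F' p h = h *\<^sub>R F' p 1" for h
      using linear_scale[OF has_derivative_linear[OF F'[OF p]], of h 1] by simp
    then have "F' p = (\<lambda>h. h *\<^sub>R F' p 1)"
      by (rule ext)
    then have "(F has_vector_derivative F' p 1) (at p within I)"
      unfolding has_vector_derivative_def by (rule subst) (rule F'[OF p])
    then show "F' p 1 = deriv_on I F p"
      using deriv_on_eqI[OF assms(1) p] by metis
  qed
qed

lemma smooth_on_continuous_on: "smooth_on S F \<Longrightarrow> continuous_on S F"
  using C_diff_on.simps(1) smooth_on_def by blast

lemma deriv_on_cong:
  assumes "nondeg_interval I" "u \<in> I" "\<And>s. s \<in> I \<Longrightarrow> F s = G s"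
  shows "deriv_on I F u = deriv_on I G u"
proof -
  have "(F has_vector_derivative D) (at u within I) = (G has_vector_derivative D) (at u within I)" for D
    by (rule has_vector_derivative_cong_ev) (simp_all add: assms)
  then show ?thesis
    by (simp add: deriv_on_def vector_derivative_def)
qed

text \<open>Lets a function be replaced by one that agrees with it only near \<open>u\<close>, for
  instance where a sign is constant.\<close>

lemma deriv_on_eqI_eventually:
  assumes "nondeg_interval I" "u \<in> I" "(F has_vector_derivative D) (at u within I)"
    and "open T" "u \<in> T" "\<And>s. s \<in> I \<Longrightarrow> s \<in> T \<Longrightarrow> F s = G s"
  shows "deriv_on I G u = D"
proof -
  have "\<forall>\<^sub>F s in at u within I. F s = G s"
    unfolding eventually_at_topological using assms by blast
  then have "(G has_vector_derivative D) (at u within I)"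
    using assms unfolding has_vector_derivative_def
    by (auto intro: has_derivative_transform_eventually)
  then show ?thesis using assms deriv_on_eqI by blast
qed

lemma deriv_on_zero_imp_const:
  assumes "nondeg_interval I" "smooth_on I F" "\<And>u. u \<in> I \<Longrightarrow> deriv_on I F u = 0"
  obtains c where "\<And>u. u \<in> I \<Longrightarrow> F u = c"
proof -
  have "\<And>u. u \<in> I \<Longrightarrow> (F has_derivative (\<lambda>h. 0)) (at u within I)"
    using smooth_on_has_deriv_on[OF assms(1) _ assms(2)] assms(3)
    by (auto simp: has_vector_derivative_def)
  then show ?thesis
    using has_derivative_zero_constant[of I F] assms(1) that
    by (metis is_interval_convex nondeg_interval_def)
qed


section \<open>Minkowski space and bivectors\<close>

lemma mink_commute: "mink a b = mink b a"
  by (simp add: mink_def)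

lemma bounded_bilinear_mink: "bounded_bilinear mink"
  unfolding bilinear_conv_bounded_bilinear[symmetric]
  unfolding bilinear_def by (intro conjI allI linearI) (simp_all add: mink_def algebra_simps)

interpretation mink: bounded_bilinear mink
  by (rule bounded_bilinear_mink)

lemma bounded_bilinear_wedge: "bounded_bilinear wedge"
  unfolding bilinear_conv_bounded_bilinear[symmetric]
  unfolding bilinear_def
  by (intro conjI allI linearI) (simp_all add: wedge_def vec_eq_iff algebra_simps)

interpretation wedge: bounded_bilinear wedge
  by (rule bounded_bilinear_wedge)

lemma wedge_self [simp]: "a \<and>\<^sub>w a = 0"
  by (simp add: wedge_def vec_eq_iff)

lemma bivector_inner_add_left: "bivector_inner (A + B) C = bivector_inner A C + bivector_inner B C"
  by (simp add: bivector_inner_def algebra_simps sum.distrib add_divide_distrib)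

lemma bivector_inner_scaleR_left: "bivector_inner (c *\<^sub>R A) C = c * bivector_inner A C"
  by (simp add: bivector_inner_def sum_distrib_left mult_ac)

lemma mink3_nth_1:
  assumes "w \<in> mink3"
  shows "w $ 1 = 0"
proof -
  have "subspace {w::real^4. w $ 1 = 0}"
    by (simp add: subspace_def)
  moreover have "{e2, e3, e4} \<subseteq> {w. w $ 1 = 0}"
    by (simp add: axis_def)
  ultimately show ?thesis
    using assms span_minimal unfolding mink3_def by blast
qed

lemma mink_e1: "mink e1 w = w $ 1"
  by (simp add: mink_def axis_def)

section \<open>Orthonormal frames with the timelike vector in last place\<close>

definition mink_frame :: "real^4 \<Rightarrow> real^4 \<Rightarrow> real^4 \<Rightarrow> real^4 \<Rightarrow> bool" where
  "mink_frame a b c d \<longleftrightarrow>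
     mink a a = 1 \<and> mink b b = 1 \<and> mink c c = 1 \<and> mink d d = -1 \<and>
     mink a b = 0 \<and> mink a c = 0 \<and> mink a d = 0 \<and> mink b c = 0 \<and> mink b d = 0 \<and> mink c d = 0"

lemma mink_frameD:
  assumes "mink_frame a b c d"
  shows "mink a a = 1" "mink b b = 1" "mink c c = 1" "mink d d = -1"
    "mink a b = 0" "mink a c = 0" "mink a d = 0" "mink b c = 0" "mink b d = 0" "mink c d = 0"
    "mink b a = 0" "mink c a = 0" "mink d a = 0" "mink c b = 0" "mink d b = 0" "mink d c = 0"
  using assms by (simp_all add: mink_frame_def mink_commute)

text \<open>Pairing the relation with each frame vector in turn isolates one coefficient.\<close>

lemma mink_frame_independent:
  assumes "mink_frame a b c d" "p *\<^sub>R a + q *\<^sub>R b + r *\<^sub>R c + s *\<^sub>R d = 0"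
  shows "p = 0 \<and> q = 0 \<and> r = 0 \<and> s = 0"
proof -
  have "mink (p *\<^sub>R a + q *\<^sub>R b + r *\<^sub>R c + s *\<^sub>R d) x = 0" for x
    using assms(2) by (simp add: mink.zero_left)
  note this[of a] this[of b] this[of c] this[of d]
  then show ?thesis
    by (simp add: mink_frameD[OF assms(1)] mink.add_left mink.scaleR_left)
qed

text \<open>By independence the coordinate map \<open>h\<close> is injective, hence surjective on a
  space of finite dimension. The last sign is negative because \<open>d\<close> has square
  -1.\<close>

lemma mink_frame_expand:
  assumes "mink_frame a b c d"
  shows "w = mink w a *\<^sub>R a + mink w b *\<^sub>R b + mink w c *\<^sub>R c - mink w d *\<^sub>R d"
proof -
  define h :: "real^4 \<Rightarrow> real^4" where
    "h = (\<lambda>w. w $ 1 *\<^sub>R a + w $ 2 *\<^sub>R b + w $ 3 *\<^sub>R c + w $ 4 *\<^sub>R d)"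
  have lin: "linear h"
    unfolding h_def by (intro linearI) (simp_all add: algebra_simps)
  have "inj h"
  proof (rule injI)
    fix x y assume "h x = h y"
    then have "(x $ 1 - y $ 1) *\<^sub>R a + (x $ 2 - y $ 2) *\<^sub>R b + (x $ 3 - y $ 3) *\<^sub>R c
      + (x $ 4 - y $ 4) *\<^sub>R d = 0"
      by (simp add: h_def algebra_simps)
    from mink_frame_independent[OF assms this] show "x = y"
      by (simp add: vec_eq_iff forall_4)
  qed
  then have "surj h"
    using lin by (simp add: linear_injective_imp_surjective)
  then obtain x where x: "w = h x" by blast
  have "mink w a = x $ 1" "mink w b = x $ 2" "mink w c = x $ 3" "mink w d = - x $ 4"
    unfolding x h_def
    by (simp_all add: mink_frameD[OF assms] mink.add_left mink.scaleR_left)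
  then show ?thesis
    using x by (simp add: h_def)
qed

section \<open>Hyperplanes orthogonal to a frame vector\<close>

lemma mink_frame_orth_spacelike:
  assumes "mink_frame a b c d"
  shows "{w. mink w c = 0} = span {a, b, d}"
proof
  have "w \<in> span {a, b, d}" if "mink w c = 0" for w
    using mink_frame_expand[OF assms, of w] that
    by (metis insertCI scaleR_zero_left add.right_neutral span_add span_base span_diff span_scale)
  then show "{w. mink w c = 0} \<subseteq> span {a, b, d}" by blast
  show "span {a, b, d} \<subseteq> {w. mink w c = 0}"
    by (rule span_minimal)
      (auto simp: mink_frameD[OF assms] subspace_def mink.add_left mink.scaleR_left mink.zero_left)
qed

lemma mink_frame_orth_timelike:
  assumes "mink_frame a b c d"
  shows "{w. mink w d = 0} = span {a, b, c}"
proof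
  have "w \<in> span {a, b, c}" if "mink w d = 0" for w
    using mink_frame_expand[OF assms, of w] that
    by (metis insertCI scaleR_zero_left diff_zero span_add span_base span_scale)
  then show "{w. mink w d = 0} \<subseteq> span {a, b, c}" by blast
  show "span {a, b, c} \<subseteq> {w. mink w d = 0}"
    by (rule span_minimal)
      (auto simp: mink_frameD[OF assms] subspace_def mink.add_left mink.scaleR_left mink.zero_left)
qed

text \<open>The vector \<open>d\<close> adds at most one to the dimension and brings it to 4, so at
  least 3 remain; the upper bound counts vectors.\<close>

lemma dim_span_three:
  fixes a b c d :: "real^4"
  assumes "\<And>w. w \<in> span (insert d {a, b, c})"
  shows "dim (span {a, b, c}) = 3"
proof -
  have "span (insert d {a, b, c}) = UNIV" using assms by blast
  then have "dim (insert d {a, b, c}) = 4"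
    using dim_span[of "insert d {a, b, c}"] by simp
  then have "3 \<le> dim {a, b, c}"
    using dim_insert[of d "{a, b, c}"] by (auto split: if_splits)
  moreover have "dim {a, b, c} \<le> 3"
    using dim_le_card'[of "{a, b, c}"] card_insert_le_m1[of 3 "{b, c}" a]
      card_insert_le_m1[of 2 "{c}" b] by simp
  ultimately show ?thesis by simp
qed

text \<open>Removing a spacelike vector from the frame leaves two spacelike vectors and a timelike
  one, a basis as the definition demands.\<close>

lemma lorentzian_hyperplane_orth:
  assumes "mink_frame a b c d"
  shows "lorentzian_hyperplane ((+) p ` {w. mink w c = 0})"
proof -
  have "w \<in> span (insert c {a, b, d})" for w
    by (subst mink_frame_expand[OF assms, of w])
      (intro span_add span_diff span_scale span_base; simp)
  then have "dim (span {a, b, d}) = 3" by (rule dim_span_three)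
  then show ?thesis
    unfolding lorentzian_hyperplane_def mink_frame_orth_spacelike[OF assms]
    using mink_frameD[OF assms] subspace_span by blast
qed

text \<open>Without the timelike component the square of a vector is the sum of the squares of its
  three coordinates.\<close>

lemma euclidean_hyperplane_orth:
  assumes "mink_frame a b c d"
  shows "euclidean_hyperplane ((+) p ` {w. mink w d = 0})"
proof -
  have "w \<in> span (insert d {a, b, c})" for w
    by (subst mink_frame_expand[OF assms, of w])
      (intro span_add span_diff span_scale span_base; simp)
  then have dim: "dim (span {a, b, c}) = 3" by (rule dim_span_three)
  have pos: "mink w w > 0" if "mink w d = 0" "w \<noteq> 0" for w
  proof -
    define x y z where "x = mink w a" and "y = mink w b" and "z = mink w c"
    have w: "w = x *\<^sub>R a + y *\<^sub>R b + z *\<^sub>R c"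
      using mink_frame_expand[OF assms, of w] that by (simp add: x_def y_def z_def)
    have "mink w w = x * mink w a + y * mink w b + z * mink w c"
      \<comment> \<open>Only the right argument is expanded, so that the left one still yields the
        coordinates.\<close>
      by (subst (2) w) (simp add: mink.add_right mink.scaleR_right)
    then have "mink w w = x\<^sup>2 + y\<^sup>2 + z\<^sup>2"
      by (simp add: x_def y_def z_def power2_eq_square)
    moreover have "x \<noteq> 0 \<or> y \<noteq> 0 \<or> z \<noteq> 0"
      using w that(2) by auto
    ultimately show ?thesis
      by (smt (verit) zero_le_power2 zero_less_power2)
  qed
  then have "\<forall>w\<in>span {a, b, c}. w \<noteq> 0 \<longrightarrow> mink w w > 0"
    using mink_frame_orth_timelike[OF assms] by blast
  then show ?thesis
    unfolding euclidean_hyperplane_def mink_frame_orth_timelike[OF assms]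
    by (intro exI[of _ p] exI[of _ "span {a, b, c}"]) (simp add: dim[unfolded dim_span])
qed


section \<open>The meridian curve\<close>

locale unit_speed_meridian =
  fixes I :: "real set" and f g :: "real \<Rightarrow> real"
  assumes I: "nondeg_interval I"
    and f: "smooth_on I f" and g: "smooth_on I g"
    and f_pos: "\<And>u. u \<in> I \<Longrightarrow> f u > 0"
    and unit_speed: "\<And>u. u \<in> I \<Longrightarrow> (deriv_on I f u)\<^sup>2 + (deriv_on I g u)\<^sup>2 = 1"
begin

abbreviation "f1 \<equiv> deriv_on I f"
abbreviation "f2 \<equiv> deriv_on I f1"
abbreviation "f3 \<equiv> deriv_on I f2"
abbreviation "g1 \<equiv> deriv_on I g"
abbreviation "g2 \<equiv> deriv_on I g1"
abbreviation "g3 \<equiv> deriv_on I g2"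

lemma smooth: "smooth_on I f1" "smooth_on I f2" "smooth_on I f3"
  "smooth_on I g1" "smooth_on I g2" "smooth_on I g3"
  by (intro smooth_on_deriv_on I f g)+

lemma has_deriv:
  assumes "u \<in> I"
  shows "(f has_real_derivative f1 u) (at u within I)"
    "(f1 has_real_derivative f2 u) (at u within I)"
    "(f2 has_real_derivative f3 u) (at u within I)"
    "(g has_real_derivative g1 u) (at u within I)"
    "(g1 has_real_derivative g2 u) (at u within I)"
    "(g2 has_real_derivative g3 u) (at u within I)"
  unfolding has_real_derivative_iff_has_vector_derivative
  using smooth_on_has_deriv_on[OF I assms] f g smooth by blast+

text \<open>Used to differentiate identities that are known only on \<open>I\<close>.\<close>

lemma deriv_unique:
  assumes "u \<in> I" "(F has_real_derivative D) (at u within I)"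
    and "(G has_real_derivative D') (at u within I)" "\<And>s. s \<in> I \<Longrightarrow> F s = G s"
  shows "D = D'"
proof -
  have "D = deriv_on I F u" "D' = deriv_on I G u"
    using assms deriv_on_eqI[OF I] unfolding has_real_derivative_iff_has_vector_derivative
    by metis+
  then show ?thesis using deriv_on_cong[OF I assms(1,4)] by simp
qed

text \<open>Half the derivative of the unit speed relation.\<close>

lemma velocity_acceleration:
  assumes "u \<in> I"
  shows "f1 u * f2 u + g1 u * g2 u = 0"
proof -
  have "((\<lambda>s. (f1 s)\<^sup>2 + (g1 s)\<^sup>2) has_real_derivative 2 * (f1 u * f2 u + g1 u * g2 u)) (at u within I)"
    by (auto intro!: derivative_eq_intros has_deriv[OF assms])
  moreover have "((\<lambda>s. 1) has_real_derivative 0) (at u within I)" by simp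
  ultimately have "2 * (f1 u * f2 u + g1 u * g2 u) = 0"
    by (rule deriv_unique[OF assms]) (rule unit_speed)
  then show ?thesis by simp
qed

text \<open>The orthogonality of velocity and acceleration, differentiated once more.\<close>

lemma velocity_jerk:
  assumes "u \<in> I"
  shows "f1 u * f3 u + g1 u * g3 u = - (f2 u)\<^sup>2 - (g2 u)\<^sup>2"
proof -
  have "((\<lambda>s. f1 s * f2 s + g1 s * g2 s) has_real_derivative
      (f1 u * f3 u + g1 u * g3 u) + ((f2 u)\<^sup>2 + (g2 u)\<^sup>2)) (at u within I)"
    by (auto intro!: derivative_eq_intros has_deriv[OF assms] simp: power2_eq_square)
  moreover have "((\<lambda>s. 0) has_real_derivative 0) (at u within I)" by simp
  ultimately have "(f1 u * f3 u + g1 u * g3 u) + ((f2 u)\<^sup>2 + (g2 u)\<^sup>2) = 0"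
    by (rule deriv_unique[OF assms]) (rule velocity_acceleration)
  then show ?thesis by simp
qed

section \<open>Curvature of the meridian and the differential equation\<close>

definition curv :: "real \<Rightarrow> real" where
  "curv u = f2 u * g1 u - f1 u * g2 u"

text \<open>The left-hand side of the differential equation, with the quotient written as the signed
  curvature: it is defined also where \<open>g' = 0\<close>.\<close>

definition ode_defect :: "real \<Rightarrow> real" where
  "ode_defect u = f u * (f1 u * curv u + f u * (f3 u * g1 u - f1 u * g3 u)) + f1 u * g1 u"

text \<open>In the derivative of \<open>curv\<close> the products \<open>f2 u * g2 u\<close> cancel,
  and only third derivatives remain.\<close>

lemma f_curv_has_deriv:
  assumes "u \<in> I"
  shows "((\<lambda>s. f s * curv s) has_real_derivative
    f1 u * curv u + f u * (f3 u * g1 u - f1 u * g3 u)) (at u within I)"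
  unfolding curv_def
  by (auto intro!: derivative_eq_intros has_deriv[OF assms] simp: algebra_simps)

lemma continuous_ode_defect: "continuous_on I ode_defect"
  unfolding ode_defect_def curv_def
  by (intro continuous_intros smooth_on_continuous_on f smooth)

lemma g1_nonzero_iff: "u \<in> I \<Longrightarrow> (f1 u)\<^sup>2 < 1 \<longleftrightarrow> g1 u \<noteq> 0"
  using unit_speed[of u] by (metis add.commute add_0 less_add_same_cancel2 not_less_iff_gr_or_eq
      zero_less_power2 power_zero_numeral)

lemma sqrt_eq_abs_g1: "u \<in> I \<Longrightarrow> sqrt (1 - (f1 u)\<^sup>2) = \<bar>g1 u\<bar>"
  using unit_speed[of u] by (metis add_diff_cancel_left' real_sqrt_abs)

text \<open>Since \<open>g1 u * g2 u = - f1 u * f2 u\<close>, the product is \<open>f2 u\<close>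
  times the squared speed.\<close>

lemma curv_times_g1: "u \<in> I \<Longrightarrow> curv u * g1 u = f2 u"
  using unit_speed[of u] velocity_acceleration[of u] unfolding curv_def by algebra

text \<open>The root is \<open>\<bar>g1 s\<bar>\<close> and the numerator is
  \<open>f s * curv s * g1 s\<close>, so the quotient is \<open>f s * curv s\<close> up to the sign
  of \<open>g1\<close>, which is constant near \<open>u\<close>.\<close>

lemma deriv_on_ode_quotient:
  assumes u: "u \<in> I" and "g1 u \<noteq> 0"
  shows "deriv_on I (\<lambda>s. f s * f2 s / sqrt (1 - (f1 s)\<^sup>2)) u =
    sgn (g1 u) * (f1 u * curv u + f u * (f3 u * g1 u - f1 u * g3 u))"
proof -
  have "continuous_on I (\<lambda>s. g1 s * g1 u)"
    by (intro continuous_intros smooth_on_continuous_on smooth)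
  \<comment> \<open>Within \<open>I\<close>, the set \<open>T\<close> consists of the points where
    \<open>g1\<close> has the same sign as at \<open>u\<close>.\<close>
  then obtain T where T: "open T" "T \<inter> I = (\<lambda>s. g1 s * g1 u) -` {0<..} \<inter> I"
    using open_greaterThan unfolding continuous_on_open_invariant by metis
  have eq: "sgn (g1 u) * (f s * curv s) = f s * f2 s / sqrt (1 - (f1 s)\<^sup>2)"
    if s: "s \<in> I" "s \<in> T" for s
  proof -
    have "g1 s * g1 u > 0" using T s by blast
    then show ?thesis
      unfolding sqrt_eq_abs_g1[OF s(1)] curv_times_g1[OF s(1), symmetric]
      by (auto simp: zero_less_mult_iff)
  qed
  have "g1 u * g1 u > 0"
    using assms(2) by (simp add: zero_less_mult_iff) linarith
  then have uT: "u \<in> T" using T u by blast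
  have der: "((\<lambda>s. sgn (g1 u) * (f s * curv s)) has_vector_derivative
      sgn (g1 u) * (f1 u * curv u + f u * (f3 u * g1 u - f1 u * g3 u))) (at u within I)"
    unfolding has_real_derivative_iff_has_vector_derivative[symmetric]
    by (intro DERIV_cmult f_curv_has_deriv u)
  show ?thesis
    by (rule deriv_on_eqI_eventually[OF I u der T(1) uT eq])
qed

text \<open>Both terms of the equation carry the factor \<open>sgn (g1 u)\<close>, which is not
  zero.\<close>

lemma ode_iff_defect:
  assumes u: "u \<in> I" and "g1 u \<noteq> 0"
  shows "f u * deriv_on I (\<lambda>s. f s * f2 s / sqrt (1 - (f1 s)\<^sup>2)) u + f1 u * sqrt (1 - (f1 u)\<^sup>2) = 0
    \<longleftrightarrow> ode_defect u = 0"
proof -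
  have "\<bar>g1 u\<bar> = sgn (g1 u) * g1 u" by (simp add: abs_sgn mult.commute)
  then have "f u * deriv_on I (\<lambda>s. f s * f2 s / sqrt (1 - (f1 s)\<^sup>2)) u + f1 u * sqrt (1 - (f1 u)\<^sup>2)
      = sgn (g1 u) * ode_defect u"
    unfolding deriv_on_ode_quotient[OF assms] sqrt_eq_abs_g1[OF u] ode_defect_def
    by (simp add: algebra_simps)
  then show ?thesis using assms(2) by (simp add: sgn_zero_iff)
qed

lemma deriv_on_zero_near:
  assumes "open T" "\<And>s. s \<in> I \<Longrightarrow> s \<in> T \<Longrightarrow> F s = 0" "u \<in> I" "u \<in> T"
  shows "deriv_on I F u = 0"
  by (rule deriv_on_eqI_eventually[OF I assms(3) has_vector_derivative_const[of 0] assms(1,4)])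
    (simp add: assms(2))

text \<open>A point with \<open>g' = 0\<close> either is a limit of points with \<open>g' \<noteq> 0\<close>, where the defect vanishes
  by continuity, or \<open>g' = 0\<close> nearby and then every term of the defect vanishes.\<close>

lemma ode_defect_zero_extend:
  assumes "\<And>u. u \<in> I \<Longrightarrow> g1 u \<noteq> 0 \<Longrightarrow> ode_defect u = 0" and u: "u \<in> I"
  shows "ode_defect u = 0"
proof (rule ccontr)
  assume ne: "ode_defect u \<noteq> 0"
  obtain T where T: "open T" "T \<inter> I = ode_defect -` (- {0}) \<inter> I"
    using continuous_ode_defect open_Compl[OF closed_singleton[of "0::real"]]
    unfolding continuous_on_open_invariant by metis
  have uT: "u \<in> T" using T u ne by blast
  have z1: "g1 s = 0" if "s \<in> I" "s \<in> T" for s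
    using assms(1) T that by blast
  then have z2: "g2 s = 0" if "s \<in> I" "s \<in> T" for s
    using deriv_on_zero_near[OF T(1)] that by blast
  then have z3: "g3 u = 0"
    using deriv_on_zero_near[OF T(1)] u uT by blast
  have "ode_defect u = 0"
    unfolding ode_defect_def curv_def using z1 z2 z3 u uT by simp
  with ne show False by simp
qed

text \<open>Restates the case without square roots and without singular points, as the Gauss map
  equation produces it.\<close>

lemma meridian_ode_case_iff:
  "meridian_ode_case I f g \<longleftrightarrow> (\<exists>u\<in>I. g1 u \<noteq> 0) \<and> (\<forall>u\<in>I. ode_defect u = 0)"
proof -
  have "\<bar>g1 u\<bar> = sqrt (1 - (f1 u)\<^sup>2)" if "u \<in> I" for u
    using sqrt_eq_abs_g1[OF that] by simp
  then have "meridian_ode_case I f g \<longleftrightarrow>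
      (\<exists>u\<in>I. g1 u \<noteq> 0) \<and> (\<forall>u\<in>I. g1 u \<noteq> 0 \<longrightarrow> ode_defect u = 0)"
    unfolding meridian_ode_case_def by (simp add: g1_nonzero_iff ode_iff_defect cong: conj_cong)
  then show ?thesis
    using ode_defect_zero_extend by blast
qed

text \<open>The coordinates of the Gauss map equation along \<open>l \<and> t\<close> and \<open>e1 \<and> t\<close> when \<open>\<kappa> = 0\<close>: their
  components along \<open>(f', g')\<close> and orthogonal to it are \<open>\<phi>\<close> and the defect.\<close>

lemma geodesic_gauss_eqs_iff:
  assumes u: "u \<in> I"
  shows "- f3 u - f1 u * f2 u / f u = \<phi> * f1 u \<and>
         - g3 u - f1 u * g2 u / f u + g1 u / (f u)\<^sup>2 = \<phi> * g1 u \<longleftrightarrow>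
         ode_defect u = 0 \<and> \<phi> = (f2 u)\<^sup>2 + (g2 u)\<^sup>2 + (g1 u / f u)\<^sup>2"
proof -
  define p where "p = - f3 u - f1 u * f2 u / f u"
  define q where "q = - g3 u - f1 u * g2 u / f u + g1 u / (f u)\<^sup>2"
  have fu: "f u \<noteq> 0" using f_pos[OF u] by simp
  have "p * f1 u + q * g1 u = - (f1 u * f3 u + g1 u * g3 u)
      - f1 u / f u * (f1 u * f2 u + g1 u * g2 u) + (g1 u / f u)\<^sup>2"
    unfolding p_def q_def
    by (simp add: power2_eq_square add_divide_distrib algebra_simps)
  then have par: "p * f1 u + q * g1 u = (f2 u)\<^sup>2 + (g2 u)\<^sup>2 + (g1 u / f u)\<^sup>2"
    by (simp add: velocity_acceleration[OF u] velocity_jerk[OF u])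
  have orth: "ode_defect u = - (f u)\<^sup>2 * (p * g1 u - q * f1 u)"
    unfolding p_def q_def ode_defect_def curv_def using fu
    by (simp add: power2_eq_square field_simps)
  have "p = \<phi> * f1 u \<and> q = \<phi> * g1 u \<longleftrightarrow> p * g1 u - q * f1 u = 0 \<and> \<phi> = p * f1 u + q * g1 u"
    using unit_speed[OF u] by (auto; algebra)
  then show ?thesis
    unfolding orth par[symmetric] p_def[symmetric] q_def[symmetric] using fu by simp
qed

lemma smooth_geodesic_phi:
  "smooth_on (I \<times> J) (\<lambda>(u, v). (f2 u)\<^sup>2 + (g2 u)\<^sup>2 + (g1 u / f u)\<^sup>2)"
  unfolding smooth_on_def split_def
proof
  fix k
  note mult = bounded_bilinear.C_diff_on_prod[OF bounded_bilinear_mult]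
  have C: "C_diff_on k I f2" "C_diff_on k I g2" "C_diff_on k I g1" "C_diff_on k I f"
    using smooth f unfolding smooth_on_def by blast+
  have inv: "C_diff_on k I (\<lambda>u. inverse (f u))"
    using C_diff_on_inverse[OF _ C(4)] f_pos by (metis less_irrefl)
  have "C_diff_on k I (\<lambda>u. f2 u * f2 u + g2 u * g2 u + (g1 u * inverse (f u)) * (g1 u * inverse (f u)))"
    by (rule C_diff_on_add[OF C_diff_on_add[OF mult[OF C(1) C(1)] mult[OF C(2) C(2)]]
          mult[OF mult[OF C(3) inv] mult[OF C(3) inv]]])
  then show "C_diff_on k (I \<times> J) (\<lambda>p. (f2 (fst p))\<^sup>2 + (g2 (fst p))\<^sup>2 + (g1 (fst p) / f (fst p))\<^sup>2)"
    unfolding power2_eq_square divide_inverse by (rule C_diff_on_fst)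
qed

text \<open>If f' vanishes, unit speed gives \<open>g1\<close> the square 1, and orthogonality of
  velocity and acceleration then gives \<open>g2 u = 0\<close>; so \<open>g1\<close> is a constant 1
  or -1.\<close>

lemma meridian_line_case_iff:
  "meridian_line_case I f g \<longleftrightarrow> (\<forall>u\<in>I. f1 u = 0)"
proof
  assume "meridian_line_case I f g"
  then obtain a where "\<And>u. u \<in> I \<Longrightarrow> f u = a"
    unfolding meridian_line_case_def by blast
  then show "\<forall>u\<in>I. f1 u = 0"
    using deriv_unique[OF _ has_deriv(1) DERIV_const[of a]] by blast
next
  assume f1: "\<forall>u\<in>I. f1 u = 0"
  obtain a where a: "\<And>u. u \<in> I \<Longrightarrow> f u = a"
    using deriv_on_zero_imp_const[OF I f] f1 by blast
  have sq: "(g1 u)\<^sup>2 = 1" if "u \<in> I" for u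
    using unit_speed[OF that] f1 that by simp
  then have "g2 u = 0" if "u \<in> I" for u
    using velocity_acceleration[OF that] f1 that
    by (metis add_0 mult_eq_0_iff power_zero_numeral zero_neq_one)
  then obtain c where c: "\<And>u. u \<in> I \<Longrightarrow> g1 u = c"
    using deriv_on_zero_imp_const[OF I smooth(4)] by blast
  \<comment> \<open>Subtracting the linear part leaves a function with zero derivative, whose
    constant value is \<open>b\<close>.\<close>
  have "((\<lambda>s. g s - c * s) has_derivative (\<lambda>h. 0)) (at u within I)" if u: "u \<in> I" for u
  proof -
    have "((\<lambda>s. g s - c * s) has_real_derivative 0) (at u within I)"
      using has_deriv(4)[OF u] c[OF u] by (auto intro!: derivative_eq_intros)
    then show ?thesis by (simp add: has_field_derivative_def lambda_zero)
  qed
  moreover have "convex I"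
    using I by (simp add: nondeg_interval_def is_interval_convex)
  ultimately obtain b where b: "\<And>u. u \<in> I \<Longrightarrow> g u - c * u = b"
    using has_derivative_zero_constant[of I "\<lambda>s. g s - c * s"] by blast
  obtain u0 where "u0 \<in> I" by (rule nondeg_interval_nonempty[OF I])
  then have "c = 1 \<or> c = -1"
    using sq c by (metis power2_eq_1_iff)
  then have "(\<forall>u\<in>I. g u = u + b) \<or> (\<forall>u\<in>I. g u = - u + b)"
    using b by (auto simp: algebra_simps)
  then show "meridian_line_case I f g"
    unfolding meridian_line_case_def using a by blast
qed

end


section \<open>The spherical curve\<close>

text \<open>The normal \<open>n\<close> is a parameter because it is determined only up to sign; its
  smoothness makes the curvature differentiable.\<close>

locale de_sitter_curve =
  fixes J :: "real set" and l n :: "real \<Rightarrow> real^4"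
  assumes J: "nondeg_interval J"
    and l: "smooth_on J l"
    and l_sphere: "\<And>v. v \<in> J \<Longrightarrow> l v \<in> de_sitter"
    and l_unit: "\<And>v. v \<in> J \<Longrightarrow> mink (deriv_on J l v) (deriv_on J l v) = 1"
    and n: "smooth_on J n"
    and n_mem: "\<And>v. v \<in> J \<Longrightarrow> n v \<in> mink3"
    and n_unit: "\<And>v. v \<in> J \<Longrightarrow> mink (n v) (n v) = -1"
    and n_l: "\<And>v. v \<in> J \<Longrightarrow> mink (n v) (l v) = 0"
    and n_t: "\<And>v. v \<in> J \<Longrightarrow> mink (n v) (deriv_on J l v) = 0"
begin

abbreviation "t \<equiv> deriv_on J l"
abbreviation "\<kappa> \<equiv> spherical_curvature J l n"
abbreviation "\<kappa>' \<equiv> deriv_on J \<kappa>"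

section \<open>Frenet equations of the spherical curve\<close>

lemma curve_has_deriv:
  assumes "v \<in> J"
  shows "(l has_vector_derivative t v) (at v within J)"
    "(t has_vector_derivative deriv_on J t v) (at v within J)"
    "(n has_vector_derivative deriv_on J n v) (at v within J)"
  using smooth_on_has_deriv_on[OF J assms] smooth_on_deriv_on[OF J] l n by blast+

text \<open>Applied to pairs of frame vectors, this gives the skew symmetry behind the Frenet
  equations.\<close>

lemma mink_const_deriv:
  assumes "v \<in> J" "\<And>s. s \<in> J \<Longrightarrow> mink (p s) (q s) = c"
    and "(p has_vector_derivative p') (at v within J)" "(q has_vector_derivative q') (at v within J)"
  shows "mink p' (q v) = - mink (p v) q'"
proof -
  have "deriv_on J (\<lambda>s. mink (p s) (q s)) v = mink (p v) q' + mink p' (q v)"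
    by (rule deriv_on_eqI[OF J assms(1) mink.has_vector_derivative[OF assms(3,4)]])
  moreover have "deriv_on J (\<lambda>s. mink (p s) (q s)) v = deriv_on J (\<lambda>s. c) v"
    by (rule deriv_on_cong[OF J assms(1,2)])
  moreover have "deriv_on J (\<lambda>s. c) v = 0"
    by (rule deriv_on_eqI[OF J assms(1)]) simp
  ultimately show ?thesis by simp
qed

lemma l_nth_1: "v \<in> J \<Longrightarrow> l v $ 1 = 0"
  using l_sphere by (simp add: de_sitter_def mink3_nth_1)

lemma l_l: "v \<in> J \<Longrightarrow> mink (l v) (l v) = 1"
  using l_sphere by (simp add: de_sitter_def)

lemma t_l: "v \<in> J \<Longrightarrow> mink (t v) (l v) = 0"
  using mink_const_deriv[OF _ l_l curve_has_deriv(1) curve_has_deriv(1)] mink_commute[of "l v" "t v"] by force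

text \<open>The first coordinate is the product with the constant vector \<open>e1\<close>.\<close>

lemma e1_orthogonal_deriv:
  fixes p :: "real \<Rightarrow> real^4"
  assumes "v \<in> J" "\<And>s. s \<in> J \<Longrightarrow> p s $ 1 = 0" "(p has_vector_derivative p') (at v within J)"
  shows "p' $ 1 = 0"
proof -
  have "mink p' e1 = - mink (p v) 0"
    by (rule mink_const_deriv[OF assms(1) _ assms(3) has_vector_derivative_const, where c = 0])
      (simp add: mink_commute[of _ e1] mink_e1 assms(2))
  then show ?thesis
    by (simp add: mink_commute[of _ e1] mink_e1 mink.zero_right)
qed

lemma t_nth_1: "v \<in> J \<Longrightarrow> t v $ 1 = 0"
  using e1_orthogonal_deriv l_nth_1 curve_has_deriv(1) by blast

lemma n_nth_1: "v \<in> J \<Longrightarrow> n v $ 1 = 0"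
  using n_mem mink3_nth_1 by blast

lemma frame:
  assumes "v \<in> J"
  shows "mink_frame e1 (l v) (t v) (n v)"
  unfolding mink_frame_def mink_e1
  using assms l_l l_unit n_unit n_l n_t t_l l_nth_1 t_nth_1 n_nth_1
  by (auto simp: mink_commute[of "l v" "t v"] mink_commute[of "l v" "n v"] mink_commute[of "t v" "n v"])

text \<open>In the frame expansion the components along \<open>e1\<close> and \<open>t\<close>
  vanish, the one along \<open>l\<close> is -1 from differentiating \<open>t_l\<close>, and the one
  along \<open>n\<close> changes sign because \<open>n\<close> is timelike.\<close>

lemma t_deriv:
  assumes v: "v \<in> J"
  shows "deriv_on J t v = - (\<kappa> v *\<^sub>R n v) - l v"
proof -
  have "deriv_on J t v $ 1 = 0"
    using e1_orthogonal_deriv[OF v t_nth_1 curve_has_deriv(2)[OF v]] by blast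
  moreover have "mink (deriv_on J t v) (l v) = - mink (t v) (t v)"
    by (rule mink_const_deriv[OF v t_l curve_has_deriv(2,1)[OF v]])
  moreover have "mink (deriv_on J t v) (t v) = - mink (t v) (deriv_on J t v)"
    by (rule mink_const_deriv[OF v l_unit curve_has_deriv(2,2)[OF v]])
  ultimately have "deriv_on J t v = - l v - \<kappa> v *\<^sub>R n v"
    using mink_frame_expand[OF frame[OF v], of "deriv_on J t v"] l_unit[OF v]
    by (simp add: mink_commute[of "t v" "deriv_on J t v"] mink_commute[of "deriv_on J t v" e1] mink_e1 spherical_curvature_def)
  then show ?thesis
    by (simp only: minus_diff_commute)
qed

text \<open>Only the component along \<open>t\<close> survives; differentiating \<open>n_t\<close>
  identifies it as \<open>- \<kappa> v\<close>.\<close>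

lemma n_deriv:
  assumes v: "v \<in> J"
  shows "deriv_on J n v = - (\<kappa> v *\<^sub>R t v)"
proof -
  have "deriv_on J n v $ 1 = 0"
    using e1_orthogonal_deriv[OF v n_nth_1 curve_has_deriv(3)[OF v]] by blast
  moreover have "mink (deriv_on J n v) (l v) = - mink (n v) (t v)"
    by (rule mink_const_deriv[OF v n_l curve_has_deriv(3,1)[OF v]])
  moreover have "mink (deriv_on J n v) (t v) = - mink (n v) (deriv_on J t v)"
    by (rule mink_const_deriv[OF v n_t curve_has_deriv(3,2)[OF v]])
  moreover have "mink (deriv_on J n v) (n v) = - mink (n v) (deriv_on J n v)"
    by (rule mink_const_deriv[OF v n_unit curve_has_deriv(3,3)[OF v]])
  ultimately show ?thesis
    using mink_frame_expand[OF frame[OF v], of "deriv_on J n v"] n_t[OF v]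
    by (simp add: mink_commute[of "n v" "deriv_on J t v"] mink_commute[of "n v" "deriv_on J n v"]
        mink_commute[of "deriv_on J n v" e1] mink_e1 spherical_curvature_def)
qed

lemma frenet:
  assumes "v \<in> J"
  shows "(t has_vector_derivative - (\<kappa> v *\<^sub>R n v) - l v) (at v within J)"
    "(n has_vector_derivative - (\<kappa> v *\<^sub>R t v)) (at v within J)"
  using curve_has_deriv(2,3)[OF assms] by (simp_all only: t_deriv[OF assms] n_deriv[OF assms])

text \<open>A first derivative suffices, as the Laplacian of the Gauss map involves only
  \<open>\<kappa>\<close> and \<open>\<kappa>'\<close>.\<close>

lemma curvature_has_deriv:
  assumes "v \<in> J"
  shows "(\<kappa> has_vector_derivative \<kappa>' v) (at v within J)"
proof -
  have "\<kappa> = (\<lambda>s. mink (deriv_on J t s) (n s))"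
    by (simp add: spherical_curvature_def fun_eq_iff)
  moreover have "(deriv_on J t has_vector_derivative deriv_on J (deriv_on J t) v) (at v within J)"
    using smooth_on_has_deriv_on[OF J assms] smooth_on_deriv_on[OF J] l by blast
  ultimately obtain D where "(\<kappa> has_vector_derivative D) (at v within J)"
    using mink.has_vector_derivative[OF _ curve_has_deriv(3)[OF assms]] by metis
  then show ?thesis
    using deriv_on_eqI[OF J assms] by metis
qed

lemma curvature_constI:
  assumes "\<And>v. v \<in> J \<Longrightarrow> \<kappa>' v = 0"
  obtains k where "\<And>v. v \<in> J \<Longrightarrow> \<kappa> v = k"
proof -
  have "\<And>v. v \<in> J \<Longrightarrow> (\<kappa> has_derivative (\<lambda>h. 0)) (at v within J)"
    using curvature_has_deriv assms by (auto simp: has_vector_derivative_def)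
  moreover have "convex J"
    using J by (simp add: nondeg_interval_def is_interval_convex)
  ultimately show ?thesis
    using has_derivative_zero_constant[of J \<kappa>] that by blast
qed

lemma curvature_const_deriv:
  assumes "\<And>v. v \<in> J \<Longrightarrow> \<kappa> v = k" "v \<in> J"
  shows "\<kappa>' v = 0"
  using deriv_on_cong[OF J assms(2,1)] deriv_on_eqI[OF J assms(2) has_vector_derivative_const]
  by simp

text \<open>The squares of \<open>t\<close> and \<open>l\<close> drop out of the first derivative.
  The second one differentiates the remaining bivector by the Frenet equations.\<close>

lemma l_wedge_t_derivs:
  assumes v: "v \<in> J"
  shows "((\<lambda>s. l s \<and>\<^sub>w t s) has_vector_derivative - (\<kappa> v *\<^sub>R (l v \<and>\<^sub>w n v))) (at v within J)"
    and "((\<lambda>s. - (\<kappa> s *\<^sub>R (l s \<and>\<^sub>w n s))) has_vector_derivative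
      (\<kappa> v)\<^sup>2 *\<^sub>R (l v \<and>\<^sub>w t v) - \<kappa>' v *\<^sub>R (l v \<and>\<^sub>w n v) - \<kappa> v *\<^sub>R (t v \<and>\<^sub>w n v)) (at v within J)"
proof -
  show "((\<lambda>s. l s \<and>\<^sub>w t s) has_vector_derivative - (\<kappa> v *\<^sub>R (l v \<and>\<^sub>w n v))) (at v within J)"
    using wedge.has_vector_derivative[OF curve_has_deriv(1)[OF v] frenet(1)[OF v]]
    by (simp add: wedge.diff_right wedge.minus_right wedge.scaleR_right)
  have "((\<lambda>s. - (\<kappa> s *\<^sub>R (l s \<and>\<^sub>w n s))) has_vector_derivative
      - (\<kappa> v *\<^sub>R (l v \<and>\<^sub>w - (\<kappa> v *\<^sub>R t v) + t v \<and>\<^sub>w n v) + \<kappa>' v *\<^sub>R (l v \<and>\<^sub>w n v))) (at v within J)"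
    by (intro has_vector_derivative_minus wedge.has_vector_derivative curve_has_deriv frenet v
        bounded_bilinear.has_vector_derivative[OF bounded_bilinear_scaleR] curvature_has_deriv)
  then show "((\<lambda>s. - (\<kappa> s *\<^sub>R (l s \<and>\<^sub>w n s))) has_vector_derivative
      (\<kappa> v)\<^sup>2 *\<^sub>R (l v \<and>\<^sub>w t v) - \<kappa>' v *\<^sub>R (l v \<and>\<^sub>w n v) - \<kappa> v *\<^sub>R (t v \<and>\<^sub>w n v)) (at v within J)"
    by (simp add: wedge.minus_right wedge.scaleR_right power2_eq_square algebra_simps)
qed

text \<open>As \<open>e1\<close> is constant, nothing cancels the component \<open>- l\<close> of
  t'; differentiated again, it produces the -1 beside the squared curvature.\<close>

lemma e1_wedge_t_derivs:
  assumes v: "v \<in> J"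
  shows "((\<lambda>s. e1 \<and>\<^sub>w t s) has_vector_derivative
      - (\<kappa> v *\<^sub>R (e1 \<and>\<^sub>w n v)) - e1 \<and>\<^sub>w l v) (at v within J)"
    and "((\<lambda>s. - (\<kappa> s *\<^sub>R (e1 \<and>\<^sub>w n s)) - e1 \<and>\<^sub>w l s) has_vector_derivative
      ((\<kappa> v)\<^sup>2 - 1) *\<^sub>R (e1 \<and>\<^sub>w t v) - \<kappa>' v *\<^sub>R (e1 \<and>\<^sub>w n v)) (at v within J)"
proof -
  \<comment> \<open>The term with 0 is the derivative of the constant \<open>e1\<close> in the
    product rule.\<close>
  have "((\<lambda>s. e1 \<and>\<^sub>w t s) has_vector_derivative
      e1 \<and>\<^sub>w (- (\<kappa> v *\<^sub>R n v) - l v) + 0 \<and>\<^sub>w t v) (at v within J)"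
    by (intro wedge.has_vector_derivative has_vector_derivative_const frenet v)
  then show "((\<lambda>s. e1 \<and>\<^sub>w t s) has_vector_derivative
      - (\<kappa> v *\<^sub>R (e1 \<and>\<^sub>w n v)) - e1 \<and>\<^sub>w l v) (at v within J)"
    by (simp add: wedge.zero_left wedge.diff_right wedge.minus_right wedge.scaleR_right)
  have "((\<lambda>s. - (\<kappa> s *\<^sub>R (e1 \<and>\<^sub>w n s)) - e1 \<and>\<^sub>w l s) has_vector_derivative
      - (\<kappa> v *\<^sub>R (e1 \<and>\<^sub>w - (\<kappa> v *\<^sub>R t v) + 0 \<and>\<^sub>w n v) + \<kappa>' v *\<^sub>R (e1 \<and>\<^sub>w n v))
      - (e1 \<and>\<^sub>w t v + 0 \<and>\<^sub>w l v)) (at v within J)"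
    by (intro has_vector_derivative_minus has_vector_derivative_diff wedge.has_vector_derivative
        curve_has_deriv frenet v has_vector_derivative_const curvature_has_deriv
        bounded_bilinear.has_vector_derivative[OF bounded_bilinear_scaleR])
  then show "((\<lambda>s. - (\<kappa> s *\<^sub>R (e1 \<and>\<^sub>w n s)) - e1 \<and>\<^sub>w l s) has_vector_derivative
      ((\<kappa> v)\<^sup>2 - 1) *\<^sub>R (e1 \<and>\<^sub>w t v) - \<kappa>' v *\<^sub>R (e1 \<and>\<^sub>w n v)) (at v within J)"
    by (simp add: wedge.zero_left wedge.minus_right wedge.scaleR_right power2_eq_square algebra_simps)
qed

text \<open>Products of frame vectors are mutually orthogonal bivectors of square 1 or -1, so
  pairing isolates each coefficient. The five listed are those that occur in the Laplacian.\<close>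

lemma wedge_frame_independent:
  assumes v: "v \<in> J"
    and zero: "a *\<^sub>R (l v \<and>\<^sub>w t v) + b *\<^sub>R (e1 \<and>\<^sub>w t v) + c *\<^sub>R (l v \<and>\<^sub>w n v)
      + d *\<^sub>R (t v \<and>\<^sub>w n v) + e *\<^sub>R (e1 \<and>\<^sub>w n v) = 0"
  shows "a = 0 \<and> b = 0 \<and> c = 0 \<and> d = 0 \<and> e = 0"
proof -
  have "bivector_inner (a *\<^sub>R (l v \<and>\<^sub>w t v) + b *\<^sub>R (e1 \<and>\<^sub>w t v) + c *\<^sub>R (l v \<and>\<^sub>w n v)
      + d *\<^sub>R (t v \<and>\<^sub>w n v) + e *\<^sub>R (e1 \<and>\<^sub>w n v)) (x \<and>\<^sub>w y) = 0" for x y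
    unfolding zero by (simp add: bivector_inner_def)
  note this[of "l v" "t v"] this[of e1 "t v"] this[of "l v" "n v"] this[of "t v" "n v"]
    this[of e1 "n v"]
  then show ?thesis
    by (simp add: bivector_inner_add_left bivector_inner_scaleR_left bivector_inner_wedge
        mink_frameD[OF frame[OF v]])
qed

end


section \<open>The meridian surface\<close>

locale hyperbolic_meridian_surface = unit_speed_meridian I f g + de_sitter_curve J l n
  for I J f g l n
begin

abbreviation "G \<equiv> gauss_map I J f g l"
abbreviation "z \<equiv> meridian_surface f g l"

text \<open>All fields to be differentiated along \<open>x\<close> are two-term combinations with
  coefficients in \<open>u\<close> and vectors fixed along the meridian.\<close>

lemma flat_x_eqI:
  fixes F :: "real \<Rightarrow> real \<Rightarrow> 'b::real_normed_vector"
  assumes "\<And>s. s \<in> I \<Longrightarrow> F s v = a s *\<^sub>R A + b s *\<^sub>R B" "u \<in> I"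
    and "(a has_real_derivative a') (at u within I)" "(b has_real_derivative b') (at u within I)"
  shows "flat_x I F u v = a' *\<^sub>R A + b' *\<^sub>R B"
proof -
  have "((\<lambda>s. a s *\<^sub>R A + b s *\<^sub>R B) has_vector_derivative a' *\<^sub>R A + b' *\<^sub>R B) (at u within I)"
    using has_vector_derivative_scaleR[OF assms(3) has_vector_derivative_const[of A]]
      has_vector_derivative_scaleR[OF assms(4) has_vector_derivative_const[of B]]
    by (auto intro: has_vector_derivative_add)
  note deriv_on_eqI[OF I assms(2) this]
  moreover have "deriv_on I (\<lambda>s. F s v) u = deriv_on I (\<lambda>s. a s *\<^sub>R A + b s *\<^sub>R B) u"
    by (rule deriv_on_cong[OF I assms(2,1)])
  ultimately show ?thesis
    unfolding flat_x_def partial_u_def by simp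
qed

text \<open>The factor \<open>1 / f u\<close> goes into the coefficients, which keeps the result in
  a form to which the rule applies again.\<close>

lemma flat_y_eqI:
  fixes F :: "real \<Rightarrow> real \<Rightarrow> 'b::real_normed_vector"
  assumes "\<And>s. s \<in> J \<Longrightarrow> F u s = a *\<^sub>R A s + b *\<^sub>R B s" "v \<in> J"
    and "(A has_vector_derivative A') (at v within J)" "(B has_vector_derivative B') (at v within J)"
  shows "flat_y J f F u v = (a / f u) *\<^sub>R A' + (b / f u) *\<^sub>R B'"
proof -
  have "((\<lambda>s. a *\<^sub>R A s + b *\<^sub>R B s) has_vector_derivative a *\<^sub>R A' + b *\<^sub>R B') (at v within J)"
    using has_vector_derivative_scaleR[OF DERIV_const assms(3)]
      has_vector_derivative_scaleR[OF DERIV_const assms(4)]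
    by (auto intro: has_vector_derivative_add)
  note deriv_on_eqI[OF J assms(2) this]
  moreover have "deriv_on J (F u) v = deriv_on J (\<lambda>s. a *\<^sub>R A s + b *\<^sub>R B s) v"
    by (rule deriv_on_cong[OF J assms(2,1)])
  ultimately show ?thesis
    unfolding flat_y_def partial_v_def by (simp add: scaleR_add_right)
qed

section \<open>Tangent frame, connection and Laplacian of the Gauss map\<close>

lemma frame_x_eq:
  assumes "u \<in> I"
  shows "frame_x I f g l u v = f1 u *\<^sub>R l v + g1 u *\<^sub>R e1"
  using flat_x_eqI[OF _ assms has_deriv(1,4)[OF assms], of z v "l v" e1]
  by (simp add: frame_x_def flat_x_def meridian_surface_def)

lemma frame_y_eq:
  assumes "u \<in> I" "v \<in> J"
  shows "frame_y J f g l u v = t v"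
  using flat_y_eqI[OF _ assms(2) curve_has_deriv(1)[OF assms(2)] has_vector_derivative_const,
      of z u "f u" "g u" e1] f_pos[OF assms(1)]
  by (simp add: frame_y_def flat_y_def meridian_surface_def)

lemma gauss_map_eq:
  assumes "u \<in> I" "v \<in> J"
  shows "G u v = f1 u *\<^sub>R (l v \<and>\<^sub>w t v) + g1 u *\<^sub>R (e1 \<and>\<^sub>w t v)"
  unfolding gauss_map_def frame_x_eq[OF assms(1)] frame_y_eq[OF assms]
  by (simp add: wedge.add_left wedge.scaleR_left)

lemma frame_orthonormal:
  assumes "u \<in> I" "v \<in> J"
  shows "mink (frame_x I f g l u v) (frame_x I f g l u v) = 1"
    "mink (frame_x I f g l u v) (frame_y J f g l u v) = 0"
  unfolding frame_x_eq[OF assms(1)] frame_y_eq[OF assms]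
  using unit_speed[OF assms(1)]
  by (simp_all add: mink.add_left mink.add_right mink.scaleR_left mink.scaleR_right
      mink_frameD[OF frame[OF assms(2)]] power2_eq_square)

text \<open>The meridians are geodesics: their acceleration is orthogonal to \<open>x\<close> by
  unit speed, and to \<open>y\<close> since it lies in the plane of \<open>l\<close> and
  \<open>e1\<close>.\<close>

lemma levi_civita_x_frame_x:
  assumes "u \<in> I" "v \<in> J"
  shows "levi_civita_x I J f g l (frame_x I f g l) u v = 0"
proof -
  have "flat_x I (frame_x I f g l) u v = f2 u *\<^sub>R l v + g2 u *\<^sub>R e1"
    by (rule flat_x_eqI[OF frame_x_eq assms(1) has_deriv(2,5)[OF assms(1)]])
  then show ?thesis
    using velocity_acceleration[OF assms(1)]
    unfolding levi_civita_x_def tangent_part_def frame_x_eq[OF assms(1)] frame_y_eq[OF assms]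
    by (simp add: mink.add_left mink.add_right mink.scaleR_left mink.scaleR_right
        mink_frameD[OF frame[OF assms(2)]])
qed

text \<open>Of the derivative of \<open>t\<close>, only the component \<open>- l\<close> has a
  tangential part, and \<open>l\<close> meets \<open>x\<close> with coefficient
  \<open>f1 u\<close>.\<close>

lemma levi_civita_y_frame_y:
  assumes "u \<in> I" "v \<in> J"
  shows "levi_civita_y I J f g l (frame_y J f g l) u v = - (f1 u / f u) *\<^sub>R frame_x I f g l u v"
proof -
  \<comment> \<open>The zero summand fills the second slot of the two-term rule.\<close>
  have "flat_y J f (frame_y J f g l) u v =
      (1 / f u) *\<^sub>R (- (\<kappa> v *\<^sub>R n v) - l v) + (0 / f u) *\<^sub>R (0::real^4)"
    by (rule flat_y_eqI[OF _ assms(2) frenet(1)[OF assms(2)] has_vector_derivative_const])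
      (simp add: frame_y_eq assms)
  then show ?thesis
    unfolding levi_civita_y_def tangent_part_def frame_x_eq[OF assms(1)] frame_y_eq[OF assms]
    by (simp add: mink.add_left mink.add_right mink.diff_left mink.minus_left mink.scaleR_left
        mink.scaleR_right mink_frameD[OF frame[OF assms(2)]])
qed

text \<open>The connection term along \<open>x\<close> vanishes and the one along \<open>y\<close>
  contributes \<open>- (f1 u / f u)\<close> times the derivative of the Gauss map along
  \<open>x\<close>.\<close>

lemma laplacian_gauss_map:
  assumes u: "u \<in> I" and v: "v \<in> J"
  shows "surface_laplacian I J f g l G u v =
    - (f3 u *\<^sub>R (l v \<and>\<^sub>w t v) + g3 u *\<^sub>R (e1 \<and>\<^sub>w t v))
    - (f1 u / f u) *\<^sub>R (f2 u *\<^sub>R (l v \<and>\<^sub>w t v) + g2 u *\<^sub>R (e1 \<and>\<^sub>w t v))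
    - ((f1 u / (f u)\<^sup>2) *\<^sub>R
         ((\<kappa> v)\<^sup>2 *\<^sub>R (l v \<and>\<^sub>w t v) - \<kappa>' v *\<^sub>R (l v \<and>\<^sub>w n v) - \<kappa> v *\<^sub>R (t v \<and>\<^sub>w n v))
       + (g1 u / (f u)\<^sup>2) *\<^sub>R (((\<kappa> v)\<^sup>2 - 1) *\<^sub>R (e1 \<and>\<^sub>w t v) - \<kappa>' v *\<^sub>R (e1 \<and>\<^sub>w n v)))"
proof -
  have Gx: "flat_x I G s v = f2 s *\<^sub>R (l v \<and>\<^sub>w t v) + g2 s *\<^sub>R (e1 \<and>\<^sub>w t v)" if "s \<in> I" for s
    by (rule flat_x_eqI[OF _ that has_deriv(2,5)[OF that]]) (rule gauss_map_eq[OF _ v])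
  have Gxx: "flat_x I (flat_x I G) u v = f3 u *\<^sub>R (l v \<and>\<^sub>w t v) + g3 u *\<^sub>R (e1 \<and>\<^sub>w t v)"
    by (rule flat_x_eqI[OF _ u has_deriv(3,6)[OF u]]) (rule Gx)
  have Gy: "flat_y J f G u s = (f1 u / f u) *\<^sub>R - (\<kappa> s *\<^sub>R (l s \<and>\<^sub>w n s))
      + (g1 u / f u) *\<^sub>R (- (\<kappa> s *\<^sub>R (e1 \<and>\<^sub>w n s)) - e1 \<and>\<^sub>w l s)" if "s \<in> J" for s
    by (rule flat_y_eqI[OF _ that l_wedge_t_derivs(1)[OF that] e1_wedge_t_derivs(1)[OF that]])
      (rule gauss_map_eq[OF u])
  have Gyy: "flat_y J f (flat_y J f G) u v = (f1 u / f u / f u) *\<^sub>R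
         ((\<kappa> v)\<^sup>2 *\<^sub>R (l v \<and>\<^sub>w t v) - \<kappa>' v *\<^sub>R (l v \<and>\<^sub>w n v) - \<kappa> v *\<^sub>R (t v \<and>\<^sub>w n v))
       + (g1 u / f u / f u) *\<^sub>R (((\<kappa> v)\<^sup>2 - 1) *\<^sub>R (e1 \<and>\<^sub>w t v) - \<kappa>' v *\<^sub>R (e1 \<and>\<^sub>w n v))"
    by (rule flat_y_eqI[OF _ v l_wedge_t_derivs(2)[OF v] e1_wedge_t_derivs(2)[OF v]]) (rule Gy)
  have xx: "flat_along I J f g l (levi_civita_x I J f g l (frame_x I f g l)) G u v = 0"
    unfolding flat_along_def levi_civita_x_frame_x[OF u v] by (simp add: mink.zero_left)
  have yy: "flat_along I J f g l (levi_civita_y I J f g l (frame_y J f g l)) G u v =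
      - (f1 u / f u) *\<^sub>R flat_x I G u v"
    unfolding flat_along_def levi_civita_y_frame_y[OF u v]
    by (simp add: mink.minus_left mink.scaleR_left frame_orthonormal[OF u v])
  show ?thesis
    unfolding surface_laplacian_def xx yy Gxx Gyy Gx[OF u] power2_eq_square[of "f u"]
    by (simp add: algebra_simps)
qed

text \<open>Compares coefficients of independent bivectors; \<open>a\<close> and \<open>b\<close>
  absorb the right-hand side, and positivity of \<open>f\<close> clears the denominators in
  \<open>c\<close>, \<open>d\<close> and \<open>e\<close>.\<close>

lemma gauss_map_equation_iff:
  assumes u: "u \<in> I" and v: "v \<in> J"
  shows "surface_laplacian I J f g l G u v = \<phi> *\<^sub>R G u v \<longleftrightarrow>
    f1 u * \<kappa>' v = 0 \<and> f1 u * \<kappa> v = 0 \<and> g1 u * \<kappa>' v = 0 \<and>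
    - f3 u - f1 u * f2 u / f u - f1 u * (\<kappa> v)\<^sup>2 / (f u)\<^sup>2 = \<phi> * f1 u \<and>
    - g3 u - f1 u * g2 u / f u - g1 u * ((\<kappa> v)\<^sup>2 - 1) / (f u)\<^sup>2 = \<phi> * g1 u"
proof -
  define a where "a = - f3 u - f1 u * f2 u / f u - f1 u * (\<kappa> v)\<^sup>2 / (f u)\<^sup>2 - \<phi> * f1 u"
  define b where "b = - g3 u - f1 u * g2 u / f u - g1 u * ((\<kappa> v)\<^sup>2 - 1) / (f u)\<^sup>2 - \<phi> * g1 u"
  define c where "c = f1 u * \<kappa>' v / (f u)\<^sup>2"
  define d where "d = f1 u * \<kappa> v / (f u)\<^sup>2"
  define e where "e = g1 u * \<kappa>' v / (f u)\<^sup>2"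
  have "surface_laplacian I J f g l G u v - \<phi> *\<^sub>R G u v =
      a *\<^sub>R (l v \<and>\<^sub>w t v) + b *\<^sub>R (e1 \<and>\<^sub>w t v) + c *\<^sub>R (l v \<and>\<^sub>w n v)
      + d *\<^sub>R (t v \<and>\<^sub>w n v) + e *\<^sub>R (e1 \<and>\<^sub>w n v)"
    unfolding laplacian_gauss_map[OF u v] gauss_map_eq[OF u v] a_def b_def c_def d_def e_def
    by (simp add: algebra_simps diff_divide_distrib)
  then have "surface_laplacian I J f g l G u v = \<phi> *\<^sub>R G u v \<longleftrightarrow>
      a = 0 \<and> b = 0 \<and> c = 0 \<and> d = 0 \<and> e = 0"
    using wedge_frame_independent[OF v, of a b c d e]
    by (metis (no_types, lifting) add.right_neutral eq_iff_diff_eq_0 scaleR_zero_left)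
  then show ?thesis
    using f_pos[OF u] unfolding a_def b_def c_def d_def e_def by auto
qed

section \<open>Classification by the constant value of the curvature\<close>

lemma curvature_derivative_zero:
  assumes "pointwise_1_type_first_kind I J f g l" "v \<in> J"
  shows "\<kappa>' v = 0"
proof -
  obtain u where u: "u \<in> I" by (rule nondeg_interval_nonempty[OF I])
  then have "f1 u * \<kappa>' v = 0" "g1 u * \<kappa>' v = 0"
    using assms gauss_map_equation_iff[OF u assms(2)]
    unfolding pointwise_1_type_first_kind_def by blast+
  then show ?thesis
    using unit_speed[OF u] by auto
qed

lemma line_accelerations:
  assumes "\<And>u. u \<in> I \<Longrightarrow> f1 u = 0" and u: "u \<in> I"
  shows "(g1 u)\<^sup>2 = 1" "f2 u = 0" "f3 u = 0" "g2 u = 0" "g3 u = 0"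
proof -
  \<comment> \<open>With the whole line as neighbourhood: a function that vanishes on
    \<open>I\<close> has zero derivative there.\<close>
  note zero = deriv_on_zero_near[OF open_UNIV _ _ UNIV_I]
  have g1: "(g1 s)\<^sup>2 = 1" if "s \<in> I" for s
    using unit_speed[OF that] assms(1)[OF that] by simp
  have f2: "f2 s = 0" if "s \<in> I" for s
    using zero assms(1) that by blast
  have g2: "g2 s = 0" if "s \<in> I" for s
    using velocity_acceleration[OF that] assms(1)[OF that] g1[OF that] by auto
  show "(g1 u)\<^sup>2 = 1" "f2 u = 0" "g2 u = 0" using g1 f2 g2 u by blast+
  show "f3 u = 0" "g3 u = 0" using zero f2 g2 u by blast+
qed

text \<open>The equation forces \<open>\<phi>\<close> to equal \<open>\<phi>0\<close>, so it remains
  to see when this sum of squares is not identically zero. If g' vanishes on \<open>I\<close>, so do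
  both second derivatives and hence \<open>\<phi>0\<close>.\<close>

lemma pointwise_geodesic_iff:
  assumes "\<And>v. v \<in> J \<Longrightarrow> \<kappa> v = 0"
  shows "pointwise_1_type_first_kind I J f g l \<longleftrightarrow> meridian_ode_case I f g"
proof -
  define \<phi>0 where "\<phi>0 u = (f2 u)\<^sup>2 + (g2 u)\<^sup>2 + (g1 u / f u)\<^sup>2" for u
  have eq: "surface_laplacian I J f g l G u v = \<phi> *\<^sub>R G u v \<longleftrightarrow> ode_defect u = 0 \<and> \<phi> = \<phi>0 u"
    if "u \<in> I" "v \<in> J" for u v \<phi>
    using geodesic_gauss_eqs_iff[OF that(1), of \<phi>] assms[OF that(2)]
      curvature_const_deriv[OF assms that(2)]
    unfolding gauss_map_equation_iff[OF that] \<phi>0_def by simp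
  obtain v0 where v0: "v0 \<in> J" by (rule nondeg_interval_nonempty[OF J])
  show ?thesis
  proof
    assume "pointwise_1_type_first_kind I J f g l"
    then obtain \<phi> u v where uv: "u \<in> I" "v \<in> J" "\<phi> u v \<noteq> 0"
      and "\<And>u v. u \<in> I \<Longrightarrow> v \<in> J \<Longrightarrow> surface_laplacian I J f g l G u v = \<phi> u v *\<^sub>R G u v"
      unfolding pointwise_1_type_first_kind_def by blast
    then have \<phi>: "ode_defect s = 0" "\<phi> s r = \<phi>0 s" if "s \<in> I" "r \<in> J" for s r
      using eq that by blast+
    have "\<exists>s\<in>I. g1 s \<noteq> 0"
    proof (rule ccontr)
      assume "\<not> (\<exists>s\<in>I. g1 s \<noteq> 0)"
      then have g1: "\<And>s. s \<in> I \<Longrightarrow> g1 s = 0" by blast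
      then have g2: "g2 u = 0"
        using deriv_on_zero_near[OF open_UNIV _ uv(1) UNIV_I] by blast
      have "f1 u \<noteq> 0" using unit_speed[OF uv(1)] g1[OF uv(1)] by auto
      then have "f2 u = 0" using velocity_acceleration[OF uv(1)] g1[OF uv(1)] by simp
      then have "\<phi>0 u = 0" by (simp add: \<phi>0_def g1 g2 uv(1))
      with \<phi>(2)[OF uv(1,2)] uv(3) show False by simp
    qed
    then show "meridian_ode_case I f g"
      unfolding meridian_ode_case_iff using \<phi>(1) v0 by blast
  next
    assume "meridian_ode_case I f g"
    then obtain s where s: "s \<in> I" "g1 s \<noteq> 0" and ode: "\<And>u. u \<in> I \<Longrightarrow> ode_defect u = 0"
      unfolding meridian_ode_case_iff by blast
    \<comment> \<open>This one square already makes \<open>\<phi>0 s\<close> positive.\<close>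
    have "(g1 s / f s)\<^sup>2 > 0"
      using s f_pos[OF s(1)] by (simp add: zero_less_power2)
    then have "\<phi>0 s > 0"
      unfolding \<phi>0_def by (simp add: add_nonneg_pos)
    then have "\<phi>0 s \<noteq> 0" by simp
    moreover have "smooth_on (I \<times> J) (\<lambda>(u, v). \<phi>0 u)"
      unfolding \<phi>0_def by (rule smooth_geodesic_phi)
    ultimately show "pointwise_1_type_first_kind I J f g l"
      unfolding pointwise_1_type_first_kind_def using eq ode s(1) v0
      by (intro exI[of _ "\<lambda>u v. \<phi>0 u"]) blast
  qed
qed

text \<open>Once f' = 0, only the equation along \<open>e1\<close> and \<open>t\<close> is left and
  fixes \<open>\<phi>\<close>; the value is zero exactly when \<open>k\<close> has square 1.\<close>

lemma pointwise_nongeodesic_iff: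
  assumes \<kappa>: "\<And>v. v \<in> J \<Longrightarrow> \<kappa> v = k" and k: "k \<noteq> 0"
  shows "pointwise_1_type_first_kind I J f g l \<longleftrightarrow> k\<^sup>2 \<noteq> 1 \<and> (\<forall>u\<in>I. f1 u = 0)"
proof -
  obtain u0 where u0: "u0 \<in> I" by (rule nondeg_interval_nonempty[OF I])
  obtain v0 where v0: "v0 \<in> J" by (rule nondeg_interval_nonempty[OF J])
  have eq: "surface_laplacian I J f g l G u v = \<phi> *\<^sub>R G u v \<longleftrightarrow> \<phi> = (1 - k\<^sup>2) / (f u)\<^sup>2"
    if f1: "\<And>u. u \<in> I \<Longrightarrow> f1 u = 0" and u: "u \<in> I" and v: "v \<in> J" for u v \<phi>
  proof -
    define c where "c = (1 - k\<^sup>2) / (f u)\<^sup>2"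
    have "g1 u \<noteq> 0" using line_accelerations(1)[OF f1 u] by auto
    moreover have "- (g1 u * (k\<^sup>2 - 1) / (f u)\<^sup>2) = c * g1 u"
      by (simp add: c_def algebra_simps diff_divide_distrib)
    ultimately show ?thesis
      unfolding gauss_map_equation_iff[OF u v] \<kappa>[OF v] f1[OF u] c_def[symmetric]
      using line_accelerations[OF f1 u] curvature_const_deriv[OF \<kappa> v]
      by auto
  qed
  show ?thesis
  proof
    assume "pointwise_1_type_first_kind I J f g l"
    then obtain \<phi> u v where uv: "u \<in> I" "v \<in> J" "\<phi> u v \<noteq> 0"
      and \<phi>: "\<And>u v. u \<in> I \<Longrightarrow> v \<in> J \<Longrightarrow> surface_laplacian I J f g l G u v = \<phi> u v *\<^sub>R G u v"
      unfolding pointwise_1_type_first_kind_def by blast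
    \<comment> \<open>The component along \<open>t\<close> and \<open>n\<close> reads
      \<open>f1 u * k = 0\<close>; one value of \<open>v\<close> suffices.\<close>
    have f1: "f1 u = 0" if u: "u \<in> I" for u
      using \<phi>[OF u v0] \<kappa>[OF v0] k unfolding gauss_map_equation_iff[OF u v0] by auto
    then have "\<phi> u v = (1 - k\<^sup>2) / (f u)\<^sup>2"
      using eq[OF f1 uv(1,2)] \<phi>[OF uv(1,2)] by blast
    with uv(3) f1 show "k\<^sup>2 \<noteq> 1 \<and> (\<forall>u\<in>I. f1 u = 0)" by auto
  next
    assume k1: "k\<^sup>2 \<noteq> 1 \<and> (\<forall>u\<in>I. f1 u = 0)"
    \<comment> \<open>As \<open>f\<close> is constant, so is \<open>\<phi>\<close>, and its
      smoothness is immediate.\<close>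
    then obtain a where a: "\<And>u. u \<in> I \<Longrightarrow> f u = a"
      using deriv_on_zero_imp_const[OF I f] by blast
    have "(1 - k\<^sup>2) / a\<^sup>2 \<noteq> 0"
      using k1 f_pos[OF u0] a[OF u0] by simp
    moreover have "smooth_on (I \<times> J) (\<lambda>(u, v). (1 - k\<^sup>2) / a\<^sup>2)"
      unfolding smooth_on_def split_def by (intro allI C_diff_on_const)
    moreover have "surface_laplacian I J f g l G u v = ((1 - k\<^sup>2) / a\<^sup>2) *\<^sub>R G u v"
      if "u \<in> I" "v \<in> J" for u v
      using eq[OF _ that] a[OF that(1)] k1 by blast
    ultimately show "pointwise_1_type_first_kind I J f g l"
      unfolding pointwise_1_type_first_kind_def using u0 v0
      by (intro exI[of _ "\<lambda>u v. (1 - k\<^sup>2) / a\<^sup>2"]) blast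
  qed
qed

theorem pointwise_1_type_iff:
  "pointwise_1_type_first_kind I J f g l \<longleftrightarrow>
    ((\<forall>v\<in>J. \<kappa> v = 0) \<and> meridian_ode_case I f g) \<or>
    (\<exists>k. k \<noteq> 0 \<and> k \<noteq> 1 \<and> k \<noteq> -1 \<and> (\<forall>v\<in>J. \<kappa> v = k) \<and> meridian_line_case I f g)"
  (is "?P \<longleftrightarrow> ?A \<or> ?B")
proof
  assume P: ?P
  obtain k where k: "\<And>v. v \<in> J \<Longrightarrow> \<kappa> v = k"
    using curvature_constI curvature_derivative_zero[OF P] by blast
  show "?A \<or> ?B"
  proof (cases "k = 0")
    case True
    then show ?thesis using pointwise_geodesic_iff P k by blast
  next
    case False
    then have "k\<^sup>2 \<noteq> 1 \<and> meridian_line_case I f g"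
      using pointwise_nongeodesic_iff[OF k False] P meridian_line_case_iff by blast
    then show ?thesis using False k by (auto simp: power2_eq_1_iff)
  qed
next
  assume "?A \<or> ?B"
  then show ?P
    using pointwise_geodesic_iff pointwise_nongeodesic_iff meridian_line_case_iff
    by (metis power2_eq_1_iff)
qed

section \<open>Geometry of the case of a straight meridian: cylinders in hyperplanes\<close>

lemma developable_line_case:
  assumes "meridian_line_case I f g"
  shows "developable_ruled_surface I J z"
proof -
  \<comment> \<open>The number \<open>\<epsilon>\<close> is 1 or -1 and merges the two forms of
    \<open>g\<close>; the generators are then parallel to \<open>e1\<close>.\<close>
  obtain a b \<epsilon> where a: "\<And>u. u \<in> I \<Longrightarrow> f u = a" and g: "\<And>u. u \<in> I \<Longrightarrow> g u = \<epsilon> * u + b"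
    and \<epsilon>: "\<epsilon> \<noteq> 0"
  proof -
    obtain a b where a: "\<forall>u\<in>I. f u = a"
      and g: "(\<forall>u\<in>I. g u = u + b) \<or> (\<forall>u\<in>I. g u = - u + b)"
      using assms unfolding meridian_line_case_def by blast
    then show thesis
      using that[of a 1 b] that[of a "-1" b] by fastforce
  qed
  have f1: "f1 u = 0" if "u \<in> I" for u
    using assms that meridian_line_case_iff by blast
  have g1: "g1 u = \<epsilon>" if u: "u \<in> I" for u
  proof -
    have "((\<lambda>s. \<epsilon> * s + b) has_real_derivative \<epsilon>) (at u within I)"
      by (auto intro!: derivative_eq_intros)
    then show ?thesis
      using deriv_unique[OF u has_deriv(4)[OF u]] g by blast
  qed
  have "C_diff_on k J (\<lambda>v. a *\<^sub>R l v + b *\<^sub>R e1)" for k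
    using l unfolding smooth_on_def
    by (intro C_diff_on_add C_diff_on_const
        bounded_bilinear.C_diff_on_prod[OF bounded_bilinear_scaleR]) blast
  then have "smooth_on J (\<lambda>v. a *\<^sub>R l v + b *\<^sub>R e1)"
    unfolding smooth_on_def by blast
  moreover have "smooth_on J (\<lambda>v. \<epsilon> *\<^sub>R e1)"
    unfolding smooth_on_def by (intro allI C_diff_on_const)
  moreover have "\<epsilon> *\<^sub>R e1 \<noteq> (0::real^4)"
    using \<epsilon> by (simp add: axis_eq_0_iff)
  moreover have "z u v = (a *\<^sub>R l v + b *\<^sub>R e1) + u *\<^sub>R \<epsilon> *\<^sub>R e1" if "u \<in> I" for u v
    unfolding meridian_surface_def a[OF that] g[OF that] by (simp add: algebra_simps)
  ultimately have "ruled_surface I J z"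
    unfolding ruled_surface_def
    by (intro exI[of _ "\<lambda>v. a *\<^sub>R l v + b *\<^sub>R e1"] exI[of _ "\<lambda>v. \<epsilon> *\<^sub>R e1"]) simp
  moreover have "tangent_plane I J z u v = span {\<epsilon> *\<^sub>R e1, a *\<^sub>R t v}" if u: "u \<in> I" and v: "v \<in> J" for u v
  proof -
    have "partial_u I z u v = \<epsilon> *\<^sub>R e1"
      using frame_x_eq[OF u, of v] f1[OF u] g1[OF u] by (simp add: frame_x_def)
    \<comment> \<open>Multiplying \<open>frame_y\<close> back by \<open>f u = a\<close> undoes the
      normalisation.\<close>
    moreover have "partial_v J z u v = a *\<^sub>R t v"
      using frame_y_eq[OF u v] f_pos[OF u] a[OF u] unfolding frame_y_def
      by (metis less_irrefl scaleR_one scaleR_scaleR nonzero_mult_div_cancel_left times_divide_eq_right mult.right_neutral)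
    ultimately show ?thesis unfolding tangent_plane_def by simp
  qed
  ultimately show ?thesis
    unfolding developable_ruled_surface_def by simp
qed

text \<open>If \<open>\<kappa>\<close> is constant then so is \<open>\<kappa> l + n\<close>, by the Frenet equations; it is the normal of the
  hyperplane and has square \<open>\<kappa>\<^sup>2 - 1\<close>.\<close>

lemma constant_normal:
  assumes \<kappa>: "\<And>v. v \<in> J \<Longrightarrow> \<kappa> v = k"
  obtains N where "\<And>v. v \<in> J \<Longrightarrow> k *\<^sub>R l v + n v = N"
proof -
  have "((\<lambda>s. k *\<^sub>R l s + n s) has_derivative (\<lambda>h. 0)) (at v within J)" if v: "v \<in> J" for v
  proof -
    have "((\<lambda>s. k *\<^sub>R l s + n s) has_vector_derivative
        (k *\<^sub>R t v + 0 *\<^sub>R l v) + - (\<kappa> v *\<^sub>R t v)) (at v within J)"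
      by (intro has_vector_derivative_add has_vector_derivative_scaleR DERIV_const
          curve_has_deriv frenet v)
    then show ?thesis by (simp add: has_vector_derivative_def \<kappa>[OF v])
  qed
  moreover have "convex J"
    using J by (simp add: nondeg_interval_def is_interval_convex)
  ultimately show ?thesis
    using has_derivative_zero_constant[of J "\<lambda>s. k *\<^sub>R l s + n s"] that by blast
qed

text \<open>The product of \<open>z\<close> with \<open>N\<close> has the constant value
  \<open>a * k\<close>, so differences of surface points are orthogonal to \<open>N\<close>. The
  factor \<open>c\<close> leaves room for normalising \<open>N\<close>.\<close>

lemma lies_in_orth_hyperplane:
  assumes a: "\<And>u. u \<in> I \<Longrightarrow> f u = a" and N: "\<And>v. v \<in> J \<Longrightarrow> k *\<^sub>R l v + n v = N"
    and "u0 \<in> I" "v0 \<in> J"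
  shows "lies_in I J z ((+) (z u0 v0) ` {w. mink w (c *\<^sub>R N) = 0})"
proof -
  have z: "mink (z u v) N = a * k" if "u \<in> I" "v \<in> J" for u v
    unfolding N[OF that(2), symmetric] meridian_surface_def a[OF that(1)]
    by (simp add: mink.add_left mink.add_right mink.scaleR_left mink.scaleR_right
        mink_frameD[OF frame[OF that(2)]])
  have "z u v \<in> (+) (z u0 v0) ` {w. mink w (c *\<^sub>R N) = 0}" if "u \<in> I" "v \<in> J" for u v
    using z[OF that] z[OF assms(3,4)]
    by (intro image_eqI[of _ _ "z u v - z u0 v0"]) (simp_all add: mink.diff_left mink.scaleR_right)
  then show ?thesis
    unfolding lies_in_def by blast
qed

text \<open>The sign of the square of the normal decides the signature of the hyperplane.\<close>

lemma hyperplane_line_case: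
  assumes \<kappa>: "\<And>v. v \<in> J \<Longrightarrow> \<kappa> v = k" and "meridian_line_case I f g"
  shows "k\<^sup>2 - 1 > 0 \<Longrightarrow> \<exists>H. lorentzian_hyperplane H \<and> lies_in I J z H"
    and "k\<^sup>2 - 1 < 0 \<Longrightarrow> \<exists>H. euclidean_hyperplane H \<and> lies_in I J z H"
proof -
  obtain a where a: "\<And>u. u \<in> I \<Longrightarrow> f u = a"
    using assms(2) unfolding meridian_line_case_def by blast
  obtain N where N: "\<And>v. v \<in> J \<Longrightarrow> k *\<^sub>R l v + n v = N"
    using constant_normal[OF \<kappa>] by blast
  obtain u0 where u0: "u0 \<in> I" by (rule nondeg_interval_nonempty[OF I])
  obtain v0 where v0: "v0 \<in> J" by (rule nondeg_interval_nonempty[OF J])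
  \<comment> \<open>In the plane of \<open>l v0\<close> and \<open>n v0\<close>, \<open>M\<close> is
    orthogonal to \<open>N\<close> with opposite square; with \<open>e1\<close> and
    \<open>t v0\<close> the two complete a frame after scaling by \<open>c\<close>.\<close>
  define M where "M = l v0 + k *\<^sub>R n v0"
  note D = mink_frameD[OF frame[OF v0]]
  note lies = lies_in_orth_hyperplane[OF a N u0 v0]
  have NN: "mink N N = k\<^sup>2 - 1" and MM: "mink M M = - (k\<^sup>2 - 1)" and MN: "mink M N = 0" "mink N M = 0"
    and e1: "mink e1 N = 0" "mink e1 M = 0" and t: "mink (t v0) N = 0" "mink (t v0) M = 0"
    unfolding N[OF v0, symmetric] M_def
    by (simp_all add: D mink.add_left mink.add_right mink.scaleR_left mink.scaleR_right power2_eq_square)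
  {
    assume k: "k\<^sup>2 - 1 > 0"
    define c where "c = 1 / sqrt (k\<^sup>2 - 1)"
    have c: "c * c * (k\<^sup>2 - 1) = 1"
      using k by (simp add: c_def)
    have "mink_frame e1 (t v0) (c *\<^sub>R N) (c *\<^sub>R M)"
      using c unfolding mink_frame_def mink.scaleR_left mink.scaleR_right NN MM MN e1 t
      by (simp add: D mult.assoc[symmetric] right_diff_distrib)
    from lorentzian_hyperplane_orth[OF this] lies
    show "\<exists>H. lorentzian_hyperplane H \<and> lies_in I J z H" by blast
  next
    assume k: "k\<^sup>2 - 1 < 0"
    define c where "c = 1 / sqrt (1 - k\<^sup>2)"
    have c: "c * c * (1 - k\<^sup>2) = 1"
      using k by (simp add: c_def)
    \<comment> \<open>Now \<open>N\<close> is timelike, so \<open>M\<close> and \<open>N\<close>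
      exchange their places in the frame.\<close>
    have "mink_frame e1 (t v0) (c *\<^sub>R M) (c *\<^sub>R N)"
      using c unfolding mink_frame_def mink.scaleR_left mink.scaleR_right NN MM MN e1 t
      by (simp add: D mult.assoc[symmetric] right_diff_distrib)
    from euclidean_hyperplane_orth[OF this] lies
    show "\<exists>H. euclidean_hyperplane H \<and> lies_in I J z H" by blast
  }
qed

end


theorem theorem5p2:
  fixes I J :: "real set"
    and f g :: "real \<Rightarrow> real"
    and l n :: "real \<Rightarrow> real^4"
  assumes I: "nondeg_interval I" and J: "nondeg_interval J"
    and f: "smooth_on I f" and g: "smooth_on I g"
    and f_pos: "\<And>u. u \<in> I \<Longrightarrow> f u > 0"
    and unit_speed: "\<And>u. u \<in> I \<Longrightarrow> (deriv_on I f u)\<^sup>2 + (deriv_on I g u)\<^sup>2 = 1"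
    and l: "smooth_on J l"
    and l_sphere: "\<And>v. v \<in> J \<Longrightarrow> l v \<in> de_sitter"
    and l_unit: "\<And>v. v \<in> J \<Longrightarrow> mink (deriv_on J l v) (deriv_on J l v) = 1"
    and n: "smooth_on J n"
    and n_mem: "\<And>v. v \<in> J \<Longrightarrow> n v \<in> mink3"
    and n_unit: "\<And>v. v \<in> J \<Longrightarrow> mink (n v) (n v) = -1"
    and n_l: "\<And>v. v \<in> J \<Longrightarrow> mink (n v) (l v) = 0"
    and n_t: "\<And>v. v \<in> J \<Longrightarrow> mink (n v) (deriv_on J l v) = 0"
  shows "(pointwise_1_type_first_kind I J f g l \<longleftrightarrow>
            ((\<forall>v\<in>J. spherical_curvature J l n v = 0) \<and> meridian_ode_case I f g) \<or>
            (\<exists>k. k \<noteq> 0 \<and> k \<noteq> 1 \<and> k \<noteq> -1 \<and> (\<forall>v\<in>J. spherical_curvature J l n v = k) \<and>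
                 meridian_line_case I f g))
       \<and> (\<forall>k. k \<noteq> 0 \<and> k \<noteq> 1 \<and> k \<noteq> -1 \<and> (\<forall>v\<in>J. spherical_curvature J l n v = k) \<and>
              meridian_line_case I f g \<longrightarrow>
            developable_ruled_surface I J (meridian_surface f g l) \<and>
            (k\<^sup>2 - 1 > 0 \<longrightarrow>
               (\<exists>H. lorentzian_hyperplane H \<and> lies_in I J (meridian_surface f g l) H)) \<and>
            (k\<^sup>2 - 1 < 0 \<longrightarrow>
               (\<exists>H. euclidean_hyperplane H \<and> lies_in I J (meridian_surface f g l) H)))"
proof -
  interpret hyperbolic_meridian_surface I J f g l n
    by unfold_locales fact+
  show ?thesis
    using pointwise_1_type_iff developable_line_case hyperplane_line_case by blast
qed

end
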